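(* Let $H_n=((x_1,y_1),\dots,(x_n,y_n))$ be generated by the adaptive linear Gaussian sampling procedure (described in the context) with a fixed sampling rule $\Lambda$, known variance $\sigma^2>0$, and true coefficient vector $\beta_0\in\mathbb{R}^p$. Let $\pi$ be a prior density for $\beta$ and $\pi(\beta\mid H_n)$ the corresponding posterior. Let $\hat\beta_n=(\mathbf{X}_n^\top\mathbf{X}_n)^{-1}\mathbf{X}_n^\top\mathbf{y}_n$ (defined whenever $\mathbf{X}_n^\top\mathbf{X}_n$ is invertible). Assume: (i) $\lambda_{\min}(\mathbf{X}_n^\top\mathbf{X}_n)\xrightarrow{p}\infty$ and $\log\lambda_{\max}(\mathbf{X}_n^\top\mathbf{X}_n)=o_p\big(\lambda_{\min}(\mathbf{X}_n^\top\mathbf{X}_n)\big)$; (ii) $\pi$ is continuous with $\pi(\beta_0)>0$. Then $$\big\|\pi(\cdot\mid H_n)-\mathcal{N}\big(\hat\beta_n,\sigma^2(\mathbf{X}_n^\top\mathbf{X}_n)^{-1}\big)\big\|_{\mathrm{TV}}\xrightarrow{p}0,$$ where convergence in probability is under the data-generating distribution with parameter $\beta_0$.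
   Context: Adaptive linear Gaussian sampling procedure: given a covariate sampling rule $\Lambda$ that maps any finite history $H_{j-1}=((x_1,y_1),\dots,(x_{j-1},y_{j-1}))\in(\mathbb{R}^p\times\mathbb{R})^{j-1}$ to a probability distribution $\Lambda(\cdot\mid H_{j-1})$ on $\mathbb{R}^p$, a coefficient vector $\beta\in\mathbb{R}^p$ and a known variance $\sigma^2>0$, set $H_0=\emptyset$ and for $j=1,\dots,n$: draw $x_j\sim\Lambda(\cdot\mid H_{j-1})$, then draw $y_j\sim\mathcal{N}(x_j^\top\beta,\sigma^2)$ (conditionally on the past and $x_j$), and set $H_j=((x_1,y_1),\dots,(x_j,y_j))$. $\mathbf{X}_n$ is the $n\times p$ matrix with $j$-th row $x_j^\top$ and $\mathbf{y}_n$ the vector with $j$-th entry $y_j$. The posterior is $\pi(\beta\mid H_n)\propto\pi(\beta)\prod_{j=1}^n\exp\!\big(-(y_j-x_j^\top\beta)^2/(2\sigma^2)\big)$. $\lambda_{\min},\lambda_{\max}$ denote the smallest and largest eigenvalues; $\|\cdot\|_{\mathrm{TV}}$ is total variation distance between probability distributions. *)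

theory Defs
  imports "HOL-Probability.Probability"
begin

type_synonym 'p hist = "nat \<Rightarrow> (real^'p) \<times> real"

text \<open>Histories of length n are elements of PiM {..<n} (the first n pairs).
  A sampling rule Lam maps (j, first j pairs) to the law of the next covariate.\<close>

definition hist_space :: "nat \<Rightarrow> ('p::finite) hist measure" where
  "hist_space n = PiM {..<n} (\<lambda>_. borel)"

fun data_law :: "(nat \<Rightarrow> ('p::finite) hist \<Rightarrow> (real^'p) measure) \<Rightarrow> real^'p \<Rightarrow> real
                   \<Rightarrow> nat \<Rightarrow> 'p hist measure" where
  "data_law Lam beta sig 0 = return (hist_space 0) (\<lambda>_. undefined)"
| "data_law Lam beta sig (Suc n) =
     data_law Lam beta sig n \<bind> (\<lambda>h. Lam n h \<bind> (\<lambda>x.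
       density lborel (normal_density (x \<bullet> beta) sig) \<bind> (\<lambda>y.
         return (hist_space (Suc n)) (h(n := (x, y))))))"

definition gram :: "nat \<Rightarrow> ('p::finite) hist \<Rightarrow> real^'p^'p" where
  "gram n h = (\<chi> i k. \<Sum>j<n. (fst (h j) $ i) * (fst (h j) $ k))"

definition xty :: "nat \<Rightarrow> ('p::finite) hist \<Rightarrow> real^'p" where
  "xty n h = (\<Sum>j<n. snd (h j) *\<^sub>R fst (h j))"

definition beta_hat :: "nat \<Rightarrow> ('p::finite) hist \<Rightarrow> real^'p" where
  "beta_hat n h = matrix_inv (gram n h) *v xty n h"

definition eigenvalues_real :: "real^'n^'n \<Rightarrow> real set" where
  "eigenvalues_real A = {l. \<exists>v. v \<noteq> 0 \<and> A *v v = l *\<^sub>R v}"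

definition lambda_min :: "real^'n^'n \<Rightarrow> real" where
  "lambda_min A = Min (eigenvalues_real A)"

definition lambda_max :: "real^'n^'n \<Rightarrow> real" where
  "lambda_max A = Max (eigenvalues_real A)"

definition lik :: "real \<Rightarrow> nat \<Rightarrow> ('p::finite) hist \<Rightarrow> real^'p \<Rightarrow> real" where
  "lik sig n h b = (\<Prod>j<n. exp (- (snd (h j) - fst (h j) \<bullet> b)\<^sup>2 / (2 * sig\<^sup>2)))"

definition posterior :: "(real^'p \<Rightarrow> real) \<Rightarrow> real \<Rightarrow> nat \<Rightarrow> ('p::finite) hist \<Rightarrow> (real^'p) measure" where
  "posterior prior sig n h =
     density lborel (\<lambda>b. ennreal (prior b * lik sig n h b /
        (\<integral>c. prior c * lik sig n h c \<partial>lborel)))"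

definition mvn :: "real^'p \<Rightarrow> real^'p^'p \<Rightarrow> (real^'p::finite) measure" where
  "mvn mu S = density lborel (\<lambda>b. ennreal
     (exp (- (1/2) * ((b - mu) \<bullet> (matrix_inv S *v (b - mu))))
       / sqrt ((2 * pi) ^ CARD('p) * det S)))"

definition tv_dist :: "'a measure \<Rightarrow> 'a measure \<Rightarrow> real" where
  "tv_dist M N = (SUP A \<in> sets M. \<bar>measure M A - measure N A\<bar>)"

text \<open>Outer probability (avoids any measurability side condition).\<close>
definition outer_prob :: "'a measure \<Rightarrow> 'a set \<Rightarrow> real" where
  "outer_prob M S = (INF A \<in> {A \<in> sets M. S \<inter> space M \<subseteq> A}. measure M A)"

end

theory Submission
  imports Defs
begin

text \<open>
  Write \<open>A\<close> for the Gram matrix, \<open>\<lambda>\<close> and \<open>\<Lambda>\<close> for its extreme eigenvalues and \<open>\<phi>\<close> for the density of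
  \<open>N(\<beta>\<^sub>n, \<sigma>\<^sup>2 A\<^sup>-\<^sup>1)\<close>, where \<open>\<beta>\<^sub>n\<close> is the least squares estimate. The likelihood is proportional to \<open>\<phi>\<close>,
  so the posterior is \<open>\<phi>\<close> reweighted by the prior \<open>\<pi>\<close>, and the total variation distance is controlled by
  \<open>\<integral> \<bar>\<pi> - \<pi>(\<beta>\<^sub>0)\<bar> \<phi>\<close>. Near \<open>\<beta>\<^sub>0\<close> this is small by continuity; at distance \<open>d\<close> from \<open>\<beta>\<^sub>n\<close> the
  density \<open>\<phi>\<close> is of order at most \<open>\<Lambda>\<^bsup>p/2\<^esup> exp (- \<lambda> d\<^sup>2 / 2\<sigma>\<^sup>2)\<close>, which vanishes since \<open>log \<Lambda> = o(\<lambda>)\<close>.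

  Consistency of \<open>\<beta>\<^sub>n\<close> under adaptive sampling comes from the mixture martingale: the likelihood ratio
  \<open>L(b) / L(\<beta>\<^sub>0)\<close> has expectation 1 for every \<open>b\<close>, hence so has its average \<open>Z\<close> over the prior, and
  \<open>Z \<le> K\<close> outside an event of probability \<open>1/K\<close>. If \<open>\<beta>\<^sub>n\<close> were at distance at least \<open>d\<close> from \<open>\<beta>\<^sub>0\<close>, then
  the ratio would exceed \<open>exp (\<lambda> d\<^sup>2 / 4\<sigma>\<^sup>2)\<close> on a ball of radius \<open>\<Lambda>\<^bsup>-1/2\<^esup>\<close> close to \<open>\<beta>\<^sub>0\<close>, so that
  \<open>Z\<close> would be at least a constant times \<open>\<Lambda>\<^bsup>-p/2\<^esup> exp (\<lambda> d\<^sup>2 / 4\<sigma>\<^sup>2)\<close>, which is unbounded.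
\<close>

section \<open>Rotation invariance and diagonalization\<close>

lemma nn_integral_lborel_translate:
  fixes f :: "'a::euclidean_space \<Rightarrow> ennreal"
  assumes "f \<in> borel_measurable borel"
  shows "(\<integral>\<^sup>+x. f (c + x) \<partial>lborel) = (\<integral>\<^sup>+x. f x \<partial>lborel)"
proof -
  have "(\<integral>\<^sup>+x. f x \<partial>lborel) = (\<integral>\<^sup>+x. f x \<partial>distr lborel borel ((+) c))"
    by (simp add: lborel_distr_plus)
  also have "\<dots> = (\<integral>\<^sup>+x. f (c + x) \<partial>lborel)"
    using assms by (subst nn_integral_distr) auto
  finally show ?thesis by simp
qed

text \<open>Both integrals are smeared with a rotation-invariant \<open>g\<close> and compared by exchanging the order
  of integration, as in the uniqueness proof for Haar measure; no determinant is needed.\<close>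

lemma nn_integral_lborel_orthogonal:
  fixes f :: "'a::euclidean_space \<Rightarrow> ennreal" and Q :: "'a \<Rightarrow> 'a"
  assumes Q: "orthogonal_transformation Q" and f[measurable]: "f \<in> borel_measurable borel"
  shows "(\<integral>\<^sup>+x. f (Q x) \<partial>lborel) = (\<integral>\<^sup>+x. f x \<partial>lborel)"
proof -
  define g :: "'a \<Rightarrow> ennreal" where "g = indicator (ball 0 1)"
  define V where "V = (\<integral>\<^sup>+x. g x \<partial>lborel)"
  have [measurable]: "g \<in> borel_measurable borel" unfolding g_def by (intro borel_measurable_indicator) auto
  have lin: "linear Q" using Q by (rule orthogonal_transformation_linear)
  have [measurable]: "Q \<in> borel_measurable borel"
    using lin by (intro borel_measurable_continuous_onI linear_continuous_on linear_conv_bounded_linear[THEN iffD1])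
  have V: "V = emeasure lborel (ball (0::'a) 1)" by (simp add: V_def g_def)
  have Vfin: "V \<noteq> \<infinity>" unfolding V using emeasure_lborel_ball_finite[of "0::'a" 1] by auto
  have V0: "V \<noteq> 0"
    using content_ball_pos[of 1 "0::'a"] unfolding V by (auto simp: measure_def)
  have g: "g (- Q x) = g x" for x
    using Q by (simp add: g_def indicator_def orthogonal_transformation_norm)
  have "V * (\<integral>\<^sup>+x. f (Q x) \<partial>lborel) = (\<integral>\<^sup>+x. V * f (Q x) \<partial>lborel)"
    by (simp add: nn_integral_cmult)
  also have "\<dots> = (\<integral>\<^sup>+x. (\<integral>\<^sup>+y. g (- Q x + y) \<partial>lborel) * f (Q x) \<partial>lborel)"
    by (simp only: nn_integral_lborel_translate[of g] V_def \<open>g \<in> borel_measurable borel\<close>)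
  also have "\<dots> = (\<integral>\<^sup>+x. \<integral>\<^sup>+y. g (- Q x + y) * f (Q x) \<partial>lborel \<partial>lborel)"
    by (simp add: nn_integral_multc)
  also have "\<dots> = (\<integral>\<^sup>+y. \<integral>\<^sup>+x. g (- Q x + y) * f (Q x) \<partial>lborel \<partial>lborel)"
    by (rule lborel_pair.Fubini') measurable
  \<comment> \<open>For fixed \<open>y\<close> the inner variable is translated by
    \<open>inv Q y\<close>. The argument of \<open>g\<close> collapses to \<open>- Q x\<close>,
    where \<open>g\<close> takes the value \<open>g x\<close> by invariance, while that of
    \<open>f\<close> becomes \<open>Q x + y\<close>. After one more exchange, translation by
    \<open>Q x\<close> removes \<open>Q\<close> altogether.\<close>
  also have "\<dots> = (\<integral>\<^sup>+y. \<integral>\<^sup>+x. g (- Q (inv Q y + x) + y) * f (Q (inv Q y + x)) \<partial>lborel \<partial>lborel)"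
    by (intro nn_integral_cong nn_integral_lborel_translate
        [where f = "\<lambda>x. g (- Q x + y) * f (Q x)" and c = "inv Q y" for y, symmetric]) auto
  also have "\<dots> = (\<integral>\<^sup>+y. \<integral>\<^sup>+x. g x * f (Q x + y) \<partial>lborel \<partial>lborel)"
    using orthogonal_transformation_surj[OF Q] lin g
    by (simp add: linear_add surj_f_inv_f add.commute)
  also have "\<dots> = (\<integral>\<^sup>+x. \<integral>\<^sup>+y. g x * f (Q x + y) \<partial>lborel \<partial>lborel)"
    by (rule lborel_pair.Fubini') measurable
  also have "\<dots> = V * (\<integral>\<^sup>+x. f x \<partial>lborel)"
    by (simp add: nn_integral_cmult nn_integral_multc nn_integral_lborel_translate[of f] V_def)
  finally show ?thesis
    using V0 Vfin by (simp add: ennreal_mult_cancel_left)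
qed

section \<open>Spectral theorem for self-adjoint maps and symmetric matrices\<close>

lemma self_adjoint_eigenvector_in_subspace:
  fixes f :: "'a::euclidean_space \<Rightarrow> 'a"
  assumes lin: "linear f" and sa: "\<And>x y. f x \<bullet> y = x \<bullet> f y"
    and S: "subspace S" "f ` S \<subseteq> S" "S \<noteq> {0}"
  obtains x l where "x \<in> S" "norm x = 1" "f x = l *\<^sub>R x"
proof -
  obtain z where z: "z \<in> S" "z \<noteq> 0" using S subspace_0 by blast
  \<comment> \<open>The eigenvector will be a maximiser of the Rayleigh quotient on the compact unit
    sphere of \<open>S\<close>, with the maximum as eigenvalue.\<close>
  have "compact (S \<inter> sphere 0 1)"
    using S(1) by (intro closed_Int_compact closed_subspace) auto
  moreover have "(1 / norm z) *\<^sub>R z \<in> S \<inter> sphere 0 1"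
    using z S(1) by (auto simp: subspace_scale)
  moreover have "continuous_on (S \<inter> sphere 0 1) (\<lambda>x. x \<bullet> f x)"
    using lin by (intro continuous_intros linear_continuous_on linear_conv_bounded_linear[THEN iffD1])
  ultimately obtain x where x: "x \<in> S" "norm x = 1"
    and max: "\<And>y. y \<in> S \<Longrightarrow> norm y = 1 \<Longrightarrow> y \<bullet> f y \<le> x \<bullet> f x"
    using continuous_attains_sup[of "S \<inter> sphere 0 1" "\<lambda>x. x \<bullet> f x"] by fastforce
  define l where "l = x \<bullet> f x"
  have le: "0 \<le> l * (v \<bullet> v) - v \<bullet> f v" if "v \<in> S" for v
  proof (cases "v = 0")
    case False
    have "(1 / norm v) *\<^sub>R v \<in> S" using that S(1) by (simp add: subspace_scale)
    then have "((1 / norm v) *\<^sub>R v) \<bullet> f ((1 / norm v) *\<^sub>R v) \<le> l"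
      unfolding l_def by (rule max) (use False in simp)
    then have "(v \<bullet> f v) / (norm v)\<^sup>2 \<le> l"
      using lin by (simp add: linear_cmul power2_eq_square)
    then show ?thesis
      using False by (simp add: divide_simps dot_square_norm split: if_splits)
  qed (use lin in \<open>simp add: linear_0\<close>)
  have xx: "x \<bullet> x = 1" using x by (simp add: dot_square_norm)
  \<comment> \<open>The form \<open>l * (v \<bullet> v) - v \<bullet> f v\<close> is nonnegative on
    \<open>S\<close> and zero at \<open>x\<close>. Along \<open>x + t *\<^sub>R v\<close> it is the
    polynomial \<open>2 * t * b + t\<^sup>2 * c\<close>, which can stay nonnegative only if
    \<open>b\<close> vanishes.\<close>
  have ort: "v \<bullet> (f x - l *\<^sub>R x) = 0" if v: "v \<in> S" for v
  proof -
    define c where "c = l * (v \<bullet> v) - v \<bullet> f v"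
    define b where "b = l * (x \<bullet> v) - v \<bullet> f x"
    have q: "0 \<le> 2 * t * b + t\<^sup>2 * c" for t
    proof -
      have "x + t *\<^sub>R v \<in> S" using x v S(1) by (simp add: subspace_add subspace_scale)
      from le[OF this] have "0 \<le> l * ((x + t *\<^sub>R v) \<bullet> (x + t *\<^sub>R v)) - (x + t *\<^sub>R v) \<bullet> (f x + t *\<^sub>R f v)"
        using lin by (simp add: linear_add linear_cmul)
      also have "\<dots> = 2 * t * b + t\<^sup>2 * c"
        using sa[of x v] xx
        by (simp add: b_def c_def l_def algebra_simps power2_eq_square inner_commute)
      finally show ?thesis .
    qed
    have c0: "c \<ge> 0" using le[OF v] by (simp add: c_def)
    have "b = 0"
    proof (rule ccontr)
      assume b: "b \<noteq> 0"
      \<comment> \<open>The minimiser in \<open>t\<close> would be \<open>- b / c\<close>; the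
        denominator \<open>c + 1\<close> stays positive when \<open>c = 0\<close> and still gives a
        negative value.\<close>
      have "0 \<le> 2 * (- b / (c + 1)) * b + (- b / (c + 1))\<^sup>2 * c" by (rule q)
      also have "\<dots> = b\<^sup>2 * (c - 2 * (c + 1)) / (c + 1)\<^sup>2"
        using c0 by (simp add: divide_simps power2_eq_square) (simp add: algebra_simps)
      also have "\<dots> < 0"
        using b c0 by (intro divide_neg_pos mult_pos_neg) auto
      finally show False by simp
    qed
    then show ?thesis by (simp add: b_def inner_diff_right inner_commute)
  qed
  \<comment> \<open>By invariance this vector lies in \<open>S\<close> itself, so \<open>ort\<close>
    makes it orthogonal to itself.\<close>
  have "f x - l *\<^sub>R x \<in> S" using x S by (auto intro!: subspace_diff subspace_scale)
  from ort[OF this] have "f x = l *\<^sub>R x" by simp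
  with x show thesis by (rule that)
qed

text \<open>Take an orthonormal set of eigenvectors of maximal cardinality. Self-adjointness makes
  its orthogonal complement invariant under \<open>f\<close>, so a nonzero complement would supply
  one more eigenvector.\<close>

lemma self_adjoint_orthonormal_eigenbasis:
  fixes f :: "'a::euclidean_space \<Rightarrow> 'a"
  assumes lin: "linear f" and sa: "\<And>x y. f x \<bullet> y = x \<bullet> f y"
  obtains B where "pairwise orthogonal B" "\<And>b. b \<in> B \<Longrightarrow> norm b = 1"
    "\<And>b. b \<in> B \<Longrightarrow> \<exists>l. f b = l *\<^sub>R b" "finite B" "card B = DIM('a)"
proof -
  define ok where "ok B \<longleftrightarrow> pairwise orthogonal B \<and> (\<forall>b\<in>B. norm b = 1 \<and> (\<exists>l. f b = l *\<^sub>R b))"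
    for B :: "'a set"
  have bound: "finite B \<and> card B \<le> DIM('a)" and ind: "independent B" if "ok B" for B
  proof -
    show "independent B"
      using that by (intro pairwise_orthogonal_independent) (auto simp: ok_def)
    then show "finite B \<and> card B \<le> DIM('a)" using independent_bound by blast
  qed
  have "ok {}" by (simp add: ok_def)
  then obtain B where B: "ok B" and max: "\<And>C. ok C \<Longrightarrow> card C \<le> card B"
    using ex_has_greatest_nat[of ok "{}" card "Suc DIM('a)"] bound by (auto simp: less_Suc_eq_le)
  define S where "S = {y. \<forall>x\<in>B. orthogonal x y}"
  have "S = {0}"
  proof (rule ccontr)
    assume ne: "S \<noteq> {0}"
    have sub: "subspace S" unfolding S_def by (rule subspace_orthogonal_to_vectors)
    have "f ` S \<subseteq> S"
    proof safe
      fix y assume y: "y \<in> S"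
      show "f y \<in> S"
        unfolding S_def orthogonal_def
      proof safe
        fix x assume x: "x \<in> B"
        then obtain l where "f x = l *\<^sub>R x" using B by (auto simp: ok_def)
        then show "x \<bullet> f y = 0"
          using sa[of x y] y x by (simp add: S_def orthogonal_def)
      qed
    qed
    from self_adjoint_eigenvector_in_subspace[OF lin sa sub this ne]
    obtain x l where x: "x \<in> S" "norm x = 1" "f x = l *\<^sub>R x" by blast
    have "ok (insert x B)"
      using B x unfolding ok_def S_def
      by (auto simp: pairwise_insert orthogonal_commute)
    moreover have "x \<notin> B" using x by (auto simp: S_def orthogonal_def)
    ultimately show False using max[of "insert x B"] bound[OF B] by simp
  qed
  moreover have "x \<in> span B" for x
  proof -
    obtain y z where yz: "y \<in> span B" "\<And>w. w \<in> span B \<Longrightarrow> orthogonal z w" "x = y + z"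
      using orthogonal_subspace_decomp_exists[of B x] by blast
    have "z \<in> S" unfolding S_def using yz(2) by (auto intro: span_base simp: orthogonal_commute)
    with yz \<open>S = {0}\<close> show ?thesis by simp
  qed
  then have "span B = UNIV" by auto
  then have "card B = DIM('a)"
    using dim_eq_card_independent[OF ind[OF B]] by (metis dim_UNIV dim_span)
  with B bound[OF B] show thesis by (intro that[of B]) (auto simp: ok_def)
qed

definition diag_matrix :: "('n \<Rightarrow> real) \<Rightarrow> real^'n^'n" where
  "diag_matrix l = (\<chi> i j. if i = j then l i else 0)"

lemma diag_matrix_mult_vec: "(diag_matrix l *v x) $ i = l i * x $ i"
  by (simp add: diag_matrix_def matrix_vector_mult_def mult_delta_left)

theorem symmetric_matrix_diagonalization:
  fixes A :: "real^'n^'n"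
  assumes sym: "transpose A = A"
  obtains P l where "orthogonal_matrix P" "A = P ** diag_matrix l ** transpose P"
proof -
  have "linear ((*v) A)" by simp
  moreover have "(A *v x) \<bullet> y = x \<bullet> (A *v y)" for x y
    by (metis dot_lmul_matrix sym transpose_matrix_vector)
  ultimately obtain B where B: "pairwise orthogonal B" "\<And>b. b \<in> B \<Longrightarrow> norm b = 1"
    "\<And>b. b \<in> B \<Longrightarrow> \<exists>l. A *v b = l *\<^sub>R b" "finite B" "card B = DIM(real^'n)"
    using self_adjoint_orthonormal_eigenbasis[of "(*v) A"] by blast
  have "card (UNIV :: 'n set) = card B" using B by simp
  then obtain e where e: "bij_betw e (UNIV :: 'n set) B"
    using finite_same_card_bij[OF finite B(4)] by blast
  have eB: "e i \<in> B" for i using e by (auto simp: bij_betw_def)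
  then have "\<forall>i. \<exists>l. A *v e i = l *\<^sub>R e i" using B(3) by simp
  from choice[OF this] obtain l where l: "\<And>i. A *v e i = l i *\<^sub>R e i" by blast
  define P where "P = (\<chi> i j. e j $ i)"
  have col: "column j P = e j" for j by (simp add: P_def column_def)
  have P: "orthogonal_matrix P"
    unfolding orthogonal_matrix_orthonormal_columns col
  proof (intro conjI allI impI)
    show "norm (e i) = 1" for i by (rule B(2)[OF eB])
    show "orthogonal (e i) (e j)" if "i \<noteq> j" for i j
    proof (rule pairwiseD[OF B(1) eB eB])
      show "e i \<noteq> e j" using e that by (auto simp: bij_betw_def dest: injD)
    qed
  qed
  have "A ** P = P ** diag_matrix l"
  proof -
    have "(A ** P) $ i $ j = (P ** diag_matrix l) $ i $ j" for i j
    proof -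
      have "(A ** P) $ i $ j = (A *v e j) $ i"
        by (simp add: matrix_matrix_mult_def matrix_vector_mult_def P_def)
      also have "\<dots> = (P ** diag_matrix l) $ i $ j"
        by (simp add: l matrix_matrix_mult_def P_def diag_matrix_def mult_delta_right)
      finally show ?thesis .
    qed
    then show ?thesis by (simp add: vec_eq_iff)
  qed
  then have "A ** (P ** transpose P) = P ** diag_matrix l ** transpose P"
    by (simp only: matrix_mul_assoc)
  with P have "A = P ** diag_matrix l ** transpose P" by (simp add: orthogonal_matrix_def)
  with P show thesis by (rule that)
qed

lemma borel_measurable_matrix_vector_mult[measurable (raw)]:
  fixes A :: "real^'n^'m"
  assumes "f \<in> borel_measurable M"
  shows "(\<lambda>x. A *v f x) \<in> borel_measurable M"
  by (rule measurable_compose[OF assms])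
     (intro borel_measurable_continuous_onI linear_continuous_on matrix_vector_mul_bounded_linear)

lemma diag_matrix_quadratic_form:
  "x \<bullet> (diag_matrix l *v x) = (\<Sum>i\<in>UNIV. l i * (x $ i)\<^sup>2)"
  by (simp add: inner_vec_def diag_matrix_mult_vec power2_eq_square mult.left_commute)

lemma det_diag_matrix: "det (diag_matrix l) = (\<Prod>i\<in>UNIV. l i)"
  by (subst det_diagonal) (auto simp: diag_matrix_def)

lemma matrix_vector_inner_transpose:
  fixes P :: "real^'n^'m"
  shows "x \<bullet> (P *v y) = (transpose P *v x) \<bullet> y"
  by (metis dot_lmul_matrix transpose_matrix_vector)

lemma orthogonal_conj_quadratic_form:
  fixes P :: "real^'n^'n"
  shows "x \<bullet> ((P ** D ** transpose P) *v x) = (transpose P *v x) \<bullet> (D *v (transpose P *v x))"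
  by (simp only: matrix_vector_mul_assoc[symmetric] matrix_vector_inner_transpose)

lemma orthogonal_matrix_inner:
  fixes P :: "real^'n^'n"
  assumes "orthogonal_matrix P"
  shows "(P *v x) \<bullet> (P *v y) = x \<bullet> y"
  using assms by (simp add: matrix_vector_inner_transpose matrix_vector_mul_assoc orthogonal_matrix)

text \<open>Ties \<open>lambda_min\<close> and \<open>lambda_max\<close> to diagonal entries; the
  finiteness of \<open>range l\<close> is what makes \<open>Min\<close> and \<open>Max\<close>
  behave.\<close>

lemma eigenvalues_orthogonal_conj:
  fixes P :: "real^'n^'n"
  assumes P: "orthogonal_matrix P"
  shows "eigenvalues_real (P ** diag_matrix l ** transpose P) = range l"
proof -
  let ?A = "P ** diag_matrix l ** transpose P"
  have inv: "P *v (transpose P *v v) = v" "transpose P *v (P *v v) = v" for v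
    using P by (simp_all add: matrix_vector_mul_assoc orthogonal_matrix_def del: transpose_matrix_vector)
  have A: "?A *v v = P *v (diag_matrix l *v (transpose P *v v))" for v
    by (simp only: matrix_vector_mul_assoc[symmetric])
  show ?thesis
  proof (intro equalityI subsetI)
    fix c assume "c \<in> eigenvalues_real ?A"
    then obtain v where v: "v \<noteq> 0" "?A *v v = c *\<^sub>R v" by (auto simp: eigenvalues_real_def)
    define w where "w = transpose P *v v"
    have "w \<noteq> 0" using v(1) inv(1)[of v] by (auto simp: w_def)
    then obtain i where i: "w $ i \<noteq> 0" by (auto simp: vec_eq_iff)
    have "diag_matrix l *v w = transpose P *v (?A *v v)"
      unfolding A w_def inv ..
    also have "\<dots> = c *\<^sub>R w" unfolding v(2) w_def by (simp add: matrix_vector_mult_scaleR)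
    finally have "(diag_matrix l *v w) $ i = (c *\<^sub>R w) $ i" by simp
    with i show "c \<in> range l" by (auto simp: diag_matrix_mult_vec)
  next
    fix c assume "c \<in> range l"
    then obtain i where i: "c = l i" by auto
    have "P *v axis i 1 \<noteq> 0" using inv(2)[of "axis i 1"] by (auto simp: axis_eq_0_iff)
    moreover have "diag_matrix l *v axis i 1 = l i *\<^sub>R axis i 1"
      by (simp add: vec_eq_iff diag_matrix_mult_vec axis_def)
    then have "?A *v (P *v axis i 1) = l i *\<^sub>R (P *v axis i 1)"
      by (simp add: A inv matrix_vector_mult_scaleR del: transpose_matrix_vector)
    ultimately show "c \<in> eigenvalues_real ?A"
      unfolding eigenvalues_real_def i by blast
  qed
qed

text \<open>In the coordinates \<open>w = transpose P *v x\<close> the norm is preserved and the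
  form is a sum of squares with weights \<open>l i\<close>, while the determinant is the product of
  the weights. Every claim then follows by comparing each \<open>l i\<close> with the
  extremes.\<close>

lemma symmetric_matrix_spectral_bounds:
  fixes A :: "real^'n^'n"
  assumes sym: "transpose A = A"
  shows lambda_min_le_quadratic_form: "lambda_min A * (norm x)\<^sup>2 \<le> x \<bullet> (A *v x)"
    and quadratic_form_le_lambda_max: "x \<bullet> (A *v x) \<le> lambda_max A * (norm x)\<^sup>2"
    and lambda_min_le_lambda_max: "lambda_min A \<le> lambda_max A"
    and det_pos_if_lambda_min_pos: "lambda_min A > 0 \<Longrightarrow> det A > 0"
    and det_le_lambda_max_power: "lambda_min A > 0 \<Longrightarrow> det A \<le> lambda_max A ^ CARD('n)"
proof -
  obtain P l where P: "orthogonal_matrix P" and A: "A = P ** diag_matrix l ** transpose P"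
    using symmetric_matrix_diagonalization[OF sym] .
  have ev: "eigenvalues_real A = range l" unfolding A by (rule eigenvalues_orthogonal_conj[OF P])
  have mn: "lambda_min A \<le> l i" and mx: "l i \<le> lambda_max A" for i
    by (simp_all add: lambda_min_def lambda_max_def ev)
  define w where "w = transpose P *v x"
  have q: "x \<bullet> (A *v x) = (\<Sum>i\<in>UNIV. l i * (w $ i)\<^sup>2)"
    unfolding A orthogonal_conj_quadratic_form w_def[symmetric] by (rule diag_matrix_quadratic_form)
  have "w \<bullet> w = x \<bullet> x"
    unfolding w_def using P by (intro orthogonal_matrix_inner) simp
  then have n: "(norm x)\<^sup>2 = (\<Sum>i\<in>UNIV. (w $ i)\<^sup>2)"
    by (simp only: dot_square_norm[symmetric]) (simp add: inner_vec_def power2_eq_square)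
  show "lambda_min A * (norm x)\<^sup>2 \<le> x \<bullet> (A *v x)" "x \<bullet> (A *v x) \<le> lambda_max A * (norm x)\<^sup>2"
    unfolding q n sum_distrib_left by (auto intro!: sum_mono mult_right_mono mn mx)
  show "lambda_min A \<le> lambda_max A" using mn mx order_trans by blast
  have "det P * det P = 1"
    using det_orthogonal_matrix[OF P] by auto
  then have det: "det A = (\<Prod>i\<in>UNIV. l i)"
    unfolding A by (simp add: det_mul det_diag_matrix mult.commute)
  show "det A > 0" if "lambda_min A > 0"
    unfolding det by (intro prod_pos less_le_trans[OF that mn] ballI)
  show "det A \<le> lambda_max A ^ CARD('n)" if "lambda_min A > 0"
    unfolding det using prod_mono[of UNIV l "\<lambda>_. lambda_max A"] mx less_le_trans[OF that mn]
    by (simp add: less_imp_le)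
qed

section \<open>Matrix inverses and scaled determinants\<close>

lemma matrix_inv_eqI:
  fixes A :: "real^'n^'n"
  assumes "B ** A = mat 1"
  shows "matrix_inv A = B"
proof -
  have AB: "A ** B = mat 1" using assms matrix_left_right_inverse by blast
  then have "A ** matrix_inv A = mat 1 \<and> matrix_inv A ** A = mat 1"
    unfolding matrix_inv_def using assms by (rule_tac someI[of _ B]) simp
  then have "matrix_inv A = (B ** A) ** matrix_inv A" "A ** matrix_inv A = mat 1"
    using assms by auto
  then show ?thesis by (simp add: matrix_mul_assoc[symmetric])
qed

lemma matrix_inv_cancel:
  fixes A :: "real^'n^'n"
  assumes "det A \<noteq> 0"
  shows "A ** matrix_inv A = mat 1" "matrix_inv A ** A = mat 1"
proof -
  obtain B where "B ** A = mat 1" using assms by (metis invertible_def invertible_det_nz)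
  moreover then have "A ** B = mat 1" using matrix_left_right_inverse by blast
  ultimately show "A ** matrix_inv A = mat 1" "matrix_inv A ** A = mat 1"
    using matrix_inv_eqI by blast+
qed

lemma det_scaleR:
  fixes A :: "real^'n^'n"
  shows "det (c *\<^sub>R A) = c ^ CARD('n) * det A"
proof -
  have "c *\<^sub>R A = diag_matrix (\<lambda>_. c) ** A"
    by (simp add: vec_eq_iff matrix_matrix_mult_def diag_matrix_def mult_delta_left)
  then show ?thesis by (simp add: det_mul det_diag_matrix)
qed

section \<open>Gaussian integrals\<close>

lemma nn_integral_gaussian_1d:
  assumes "c > 0"
  shows "(\<integral>\<^sup>+x. ennreal (exp (- c * x\<^sup>2)) \<partial>lborel) = ennreal (sqrt (pi / c))"
proof -
  define s where "s = sqrt (1 / (2 * c))"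
  have s: "s > 0" "s\<^sup>2 = 1 / (2 * c)" using assms by (auto simp: s_def)
  have "2 * pi * s\<^sup>2 = pi / c" "- (x - 0)\<^sup>2 / (2 * s\<^sup>2) = - c * x\<^sup>2" for x :: real
    using assms by (simp_all add: s)
  then have "exp (- c * x\<^sup>2) = sqrt (pi / c) * normal_density 0 s x" for x
    unfolding normal_density_def using assms by simp
  then have "(\<integral>\<^sup>+x. ennreal (exp (- c * x\<^sup>2)) \<partial>lborel)
      = (\<integral>\<^sup>+x. ennreal (sqrt (pi / c)) * ennreal (normal_density 0 s x) \<partial>lborel)"
    using assms by (simp add: ennreal_mult)
  also have "\<dots> = ennreal (sqrt (pi / c)) * (\<integral>\<^sup>+x. ennreal (normal_density 0 s x) \<partial>lborel)"
    by (rule nn_integral_cmult) simp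
  also have "(\<integral>\<^sup>+x. ennreal (normal_density 0 s x) \<partial>lborel) = 1"
    using s by (subst nn_integral_eq_integral) auto
  finally show ?thesis by simp
qed

text \<open>The product rule for \<open>lborel\<close> is indexed by \<open>Basis\<close>; the
  injection sending \<open>i\<close> to \<open>axis i 1\<close> reindexes it by coordinates.\<close>

lemma nn_integral_lborel_prod_vec:
  fixes f :: "'n::finite \<Rightarrow> real \<Rightarrow> ennreal"
  assumes [measurable]: "\<And>i. f i \<in> borel_measurable borel"
  shows "(\<integral>\<^sup>+x. (\<Prod>i\<in>UNIV. f i (x $ i)) \<partial>lborel) = (\<Prod>i\<in>UNIV. \<integral>\<^sup>+x. f i x \<partial>lborel)"
proof -
  define e :: "'n \<Rightarrow> real^'n" where "e i = axis i 1" for i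
  have inj: "inj e" by (auto simp: inj_def e_def axis_eq_axis)
  have B: "Basis = range e" by (auto simp: Basis_vec_def e_def)
  have [simp]: "inv e (e i) = i" for i using inj by simp
  have "(\<integral>\<^sup>+x. (\<Prod>b\<in>Basis. f (inv e b) (x \<bullet> b)) \<partial>lborel)
      = (\<Prod>b\<in>Basis. \<integral>\<^sup>+x. f (inv e b) x \<partial>lborel)"
    by (rule nn_integral_lborel_prod) auto
  then show ?thesis
    unfolding B using inj by (simp add: prod.reindex) (simp add: e_def inner_axis)
qed

lemma sqrt_prod: "sqrt (\<Prod>i\<in>S. f i) = (\<Prod>i\<in>S. sqrt (f i))"
  by (induction S rule: infinite_finite_induct) (auto simp: real_sqrt_mult)

text \<open>Rotating into the eigenbasis leaves Lebesgue measure unchanged and splits the integrand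
  into one-dimensional Gaussians with exponents \<open>c * l i\<close>.\<close>

lemma nn_integral_gaussian_quadratic_form:
  fixes A :: "real^'n^'n"
  assumes sym: "transpose A = A" and pos: "lambda_min A > 0" and c: "c > 0"
  shows "(\<integral>\<^sup>+x. ennreal (exp (- c * (x \<bullet> (A *v x)))) \<partial>lborel)
    = ennreal (sqrt ((pi / c) ^ CARD('n) / det A))"
proof -
  obtain P l where P: "orthogonal_matrix P" and A: "A = P ** diag_matrix l ** transpose P"
    using symmetric_matrix_diagonalization[OF sym] .
  have ev: "eigenvalues_real A = range l" unfolding A by (rule eigenvalues_orthogonal_conj[OF P])
  have l: "l i > 0" for i
    by (rule less_le_trans[OF pos]) (simp add: lambda_min_def ev)
  have "det P * det P = 1"
    using det_orthogonal_matrix[OF P] by auto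
  then have det: "det A = (\<Prod>i\<in>UNIV. l i)"
    unfolding A by (simp add: det_mul det_diag_matrix mult.commute)
  have q: "(P *v x) \<bullet> (A *v (P *v x)) = (\<Sum>i\<in>UNIV. l i * (x $ i)\<^sup>2)" for x
    unfolding A orthogonal_conj_quadratic_form diag_matrix_quadratic_form[symmetric]
    using P by (simp add: matrix_vector_mul_assoc orthogonal_matrix_def del: transpose_matrix_vector)
  have ot: "orthogonal_transformation ((*v) P)"
    using P by (simp add: orthogonal_transformation_def orthogonal_matrix_inner)
  have "(\<integral>\<^sup>+x. ennreal (exp (- c * (x \<bullet> (A *v x)))) \<partial>lborel)
      = (\<integral>\<^sup>+x. ennreal (exp (- c * ((P *v x) \<bullet> (A *v (P *v x))))) \<partial>lborel)"
    by (rule nn_integral_lborel_orthogonal[OF ot, symmetric])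
       measurable
  also have "\<dots> = (\<integral>\<^sup>+x. (\<Prod>i\<in>UNIV. ennreal (exp (- (c * l i) * (x $ i)\<^sup>2))) \<partial>lborel)"
    unfolding q by (simp add: prod_ennreal exp_sum[symmetric] sum_distrib_left sum_negf mult.assoc)
  also have "\<dots> = (\<Prod>i\<in>UNIV. \<integral>\<^sup>+x. ennreal (exp (- (c * l i) * x\<^sup>2)) \<partial>lborel)"
    by (rule nn_integral_lborel_prod_vec) simp
  also have "\<dots> = (\<Prod>i\<in>UNIV. ennreal (sqrt (pi / (c * l i))))"
    using c l by (intro prod.cong refl nn_integral_gaussian_1d) auto
  also have "\<dots> = ennreal (\<Prod>i\<in>UNIV. sqrt (pi / (c * l i)))"
    using c l by (intro prod_ennreal) (simp add: less_imp_le)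
  also have "(\<Prod>i\<in>UNIV. sqrt (pi / (c * l i))) = sqrt (\<Prod>i\<in>UNIV. (pi / c) / l i)"
    by (simp add: sqrt_prod)
  also have "(\<Prod>i\<in>UNIV. (pi / c) / l i) = (pi / c) ^ CARD('n) / det A"
    by (simp only: det prod_dividef prod_constant power_divide)
  finally show ?thesis .
qed

section \<open>Least squares and the likelihood\<close>

lemma transpose_gram: "transpose (gram n h) = gram n h"
  by (simp add: gram_def transpose_def mult.commute)

lemma gram_mult_vec: "gram n h *v v = (\<Sum>j<n. (fst (h j) \<bullet> v) *\<^sub>R fst (h j))"
  by (simp add: vec_eq_iff gram_def matrix_vector_mult_def inner_vec_def sum_distrib_right
      sum_distrib_left sum.swap[of _ "{..<n}"] mult_ac)

lemma gram_quadratic_form: "v \<bullet> (gram n h *v v) = (\<Sum>j<n. (fst (h j) \<bullet> v)\<^sup>2)"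
  by (simp add: gram_mult_vec inner_sum_right power2_eq_square inner_commute)

lemma gram_mult_beta_hat:
  assumes "det (gram n h) \<noteq> 0"
  shows "gram n h *v beta_hat n h = xty n h"
  using matrix_inv_cancel[OF assms] by (simp add: beta_hat_def matrix_vector_mul_assoc)

text \<open>Pythagoras: by the normal equations the least squares residuals are orthogonal to the
  image of the design matrix, so the cross term vanishes.\<close>

lemma residual_sum_decomposition:
  assumes "det (gram n h) \<noteq> 0"
  shows "(\<Sum>j<n. (snd (h j) - fst (h j) \<bullet> b)\<^sup>2) = (\<Sum>j<n. (snd (h j) - fst (h j) \<bullet> beta_hat n h)\<^sup>2)
    + (b - beta_hat n h) \<bullet> (gram n h *v (b - beta_hat n h))"
proof -
  let ?m = "beta_hat n h"
  have "(\<Sum>j<n. (snd (h j) - fst (h j) \<bullet> ?m) *\<^sub>R fst (h j)) = xty n h - gram n h *v ?m"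
    by (simp add: xty_def gram_mult_vec scaleR_left_diff_distrib sum_subtractf)
  also have "\<dots> = 0" using gram_mult_beta_hat[OF assms] by simp
  finally have 0: "(\<Sum>j<n. (snd (h j) - fst (h j) \<bullet> ?m) * (fst (h j) \<bullet> (b - ?m))) = 0"
    by (metis (mono_tags, lifting) inner_sum_left inner_scaleR_left inner_zero_left sum.cong)
  have "(snd (h j) - fst (h j) \<bullet> b)\<^sup>2 = (snd (h j) - fst (h j) \<bullet> ?m)\<^sup>2
      - 2 * ((snd (h j) - fst (h j) \<bullet> ?m) * (fst (h j) \<bullet> (b - ?m))) + (fst (h j) \<bullet> (b - ?m))\<^sup>2" for j
    by (simp add: inner_diff_right power2_eq_square algebra_simps)
  then show ?thesis
    using 0 by (simp add: gram_quadratic_form sum.distrib sum_subtractf sum_distrib_left[symmetric])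
qed

lemma lik_eq_exp_sum: "lik sig n h b = exp (- (\<Sum>j<n. (snd (h j) - fst (h j) \<bullet> b)\<^sup>2) / (2 * sig\<^sup>2))"
  by (simp add: lik_def exp_sum[symmetric] sum_negf sum_divide_distrib)

text \<open>Completing the square in \<open>b\<close>. This identity turns the posterior into a
  reweighted Gaussian and also evaluates the likelihood ratio against the true parameter.\<close>

lemma lik_gaussian:
  assumes "det (gram n h) \<noteq> 0"
  shows "lik sig n h b = lik sig n h (beta_hat n h) *
    exp (- (1 / (2 * sig\<^sup>2)) * ((b - beta_hat n h) \<bullet> (gram n h *v (b - beta_hat n h))))"
  unfolding lik_eq_exp_sum residual_sum_decomposition[OF assms, of b] exp_add[symmetric]
  by (simp add: diff_divide_distrib)

section \<open>The data law and the likelihood ratio martingale\<close>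

lemma space_hist_space: "space (hist_space n) = PiE {..<n} (\<lambda>_. UNIV)"
  by (simp add: hist_space_def space_PiM)

lemma measurable_hist_component[measurable (raw)]:
  "j < n \<Longrightarrow> f \<in> M \<rightarrow>\<^sub>M hist_space n \<Longrightarrow> (\<lambda>h. f h j) \<in> M \<rightarrow>\<^sub>M borel"
  unfolding hist_space_def by (rule measurable_component_singleton[THEN measurable_compose[rotated]]) auto

lemma measurable_hist_extend[measurable (raw)]:
  fixes g :: "'a \<Rightarrow> ('p::finite) hist"
  assumes "g \<in> M \<rightarrow>\<^sub>M hist_space n" "x \<in> borel_measurable M" "y \<in> borel_measurable M"
  shows "(\<lambda>w. (g w)(n := (x w, y w))) \<in> M \<rightarrow>\<^sub>M hist_space (Suc n)"
  unfolding hist_space_def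
proof (rule measurable_fun_upd)
  show "{..<Suc n} = {..<n} \<union> {n}" by auto
  show "g \<in> M \<rightarrow>\<^sub>M PiM {..<n} (\<lambda>_. borel)" using assms(1) by (simp add: hist_space_def)
  show "(\<lambda>w. (x w, y w)) \<in> M \<rightarrow>\<^sub>M borel"
    using assms(2,3) by (simp add: borel_prod[symmetric])
qed

lemma measurable_normal_kernel:
  fixes beta :: "'a::euclidean_space"
  assumes "sig > 0"
  shows "(\<lambda>x. density lborel (normal_density (x \<bullet> beta) sig)) \<in> borel \<rightarrow>\<^sub>M prob_algebra borel"
proof (rule measurable_prob_algebraI)
  show "prob_space (density lborel (normal_density (x \<bullet> beta) sig))" for x
    using assms by (rule prob_space_normal_density)
  show "(\<lambda>x. density lborel (normal_density (x \<bullet> beta) sig)) \<in> borel \<rightarrow>\<^sub>M subprob_algebra borel"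
  proof (rule measurable_subprob_algebra)
    show "subprob_space (density lborel (normal_density (x \<bullet> beta) sig))" for x
      using assms by (intro prob_space_imp_subprob_space prob_space_normal_density)
    fix A :: "real set" assume [measurable]: "A \<in> sets borel"
    show "(\<lambda>x. emeasure (density lborel (normal_density (x \<bullet> beta) sig)) A) \<in> borel_measurable borel"
      by (simp add: emeasure_density normal_density_def)
  qed simp
qed

lemma borel_measurable_lik[measurable (raw)]:
  assumes [measurable]: "f \<in> M \<rightarrow>\<^sub>M hist_space n" "g \<in> borel_measurable M"
  shows "(\<lambda>w. lik s n (f w) (g w)) \<in> borel_measurable M"
proof -
  have [measurable]: "(\<lambda>w. fst (f w j)) \<in> borel_measurable M" "(\<lambda>w. snd (f w j)) \<in> borel_measurable M"
    if "j < n" for j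
  proof -
    have "(\<lambda>w. f w j) \<in> M \<rightarrow>\<^sub>M borel \<Otimes>\<^sub>M borel" using that by (simp add: borel_prod) measurable
    then show "(\<lambda>w. fst (f w j)) \<in> borel_measurable M" "(\<lambda>w. snd (f w j)) \<in> borel_measurable M"
      by measurable
  qed
  show ?thesis
    unfolding lik_def by (intro borel_measurable_prod) simp
qed

lemma lik_extend: "lik s (Suc n) (h(n := (x, y))) b
    = lik s n h b * exp (- (y - x \<bullet> b)\<^sup>2 / (2 * s\<^sup>2))"
  by (simp add: lik_def)

lemma lik_pos: "lik s n h b > 0"
  by (simp add: lik_def prod_pos)

locale adaptive_gaussian_sampling =
  fixes Lam :: "nat \<Rightarrow> ('p::finite) hist \<Rightarrow> (real^'p) measure"
    and beta0 :: "real^'p" and sig :: real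
  assumes sigma_pos: "sig > 0"
    and Lam_kernel: "\<And>j. Lam j \<in> hist_space j \<rightarrow>\<^sub>M prob_algebra borel"
begin

abbreviation "noise x \<equiv> density lborel (normal_density (x \<bullet> beta0) sig)"

abbreviation "law \<equiv> data_law Lam beta0 sig"

lemma obs_kernel:
  assumes "f \<in> M \<rightarrow>\<^sub>M hist_space n" "x \<in> borel_measurable M"
  shows "(\<lambda>w. noise (x w) \<bind> (\<lambda>y. return (hist_space (Suc n)) ((f w)(n := (x w, y)))))
    \<in> M \<rightarrow>\<^sub>M prob_algebra (hist_space (Suc n))"
proof (rule measurable_bind_prob_space2)
  show "(\<lambda>w. noise (x w)) \<in> M \<rightarrow>\<^sub>M prob_algebra borel"
    by (rule measurable_compose[OF assms(2) measurable_normal_kernel[OF sigma_pos]])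
  note assms[measurable]
  have "(\<lambda>(w, y). (f w)(n := (x w, y))) \<in> M \<Otimes>\<^sub>M borel \<rightarrow>\<^sub>M hist_space (Suc n)"
    unfolding split_beta' by measurable
  then show "(\<lambda>(w, y). return (hist_space (Suc n)) ((f w)(n := (x w, y))))
      \<in> M \<Otimes>\<^sub>M borel \<rightarrow>\<^sub>M prob_algebra (hist_space (Suc n))"
    unfolding split_beta' by (rule measurable_compose[OF _ measurable_return_prob_space])
qed

lemma step_kernel:
  "(\<lambda>h. Lam n h \<bind> (\<lambda>x. noise x \<bind> (\<lambda>y. return (hist_space (Suc n)) (h(n := (x, y))))))
    \<in> hist_space n \<rightarrow>\<^sub>M prob_algebra (hist_space (Suc n))"
proof (rule measurable_bind_prob_space2[OF Lam_kernel])
  show "(\<lambda>(h, x). noise x \<bind> (\<lambda>y. return (hist_space (Suc n)) (h(n := (x, y)))))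
      \<in> hist_space n \<Otimes>\<^sub>M borel \<rightarrow>\<^sub>M prob_algebra (hist_space (Suc n))"
    unfolding split_beta' by (rule obs_kernel) measurable
qed

lemma law_in_prob_algebra: "law n \<in> space (prob_algebra (hist_space n))"
proof (induction n)
  case 0
  \<comment> \<open>The product over the empty index set has the constantly \<open>undefined\<close>
    function as its only point.\<close>
  have "(\<lambda>_. undefined) \<in> space (hist_space 0 :: 'p hist measure)"
    by (simp add: space_hist_space)
  then show ?case
    by (simp add: space_prob_algebra prob_space_return)
next
  case (Suc n)
  \<comment> \<open>The measure \<open>law n\<close> is viewed as a constant kernel on a one-point
    space, so that closure of kernels under bind applies to it.\<close>
  then show ?case
    using measurable_space[OF measurable_bind_prob_space[OF measurable_const step_kernel],
        of "law n" n "()" "count_space UNIV"]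
    by simp
qed

lemma prob_space_law: "prob_space (law n)" and sets_law[measurable_cong]: "sets (law n) = sets (hist_space n)"
  using law_in_prob_algebra[of n] by (auto simp: space_prob_algebra)

text \<open>The tower property behind the induction on \<open>n\<close>: the nested binds of one
  sampling step are peeled off from the outside in.\<close>

lemma nn_integral_law_Suc:
  assumes f[measurable]: "f \<in> borel_measurable (hist_space (Suc n))"
  shows "(\<integral>\<^sup>+h. f h \<partial>law (Suc n))
    = (\<integral>\<^sup>+h. \<integral>\<^sup>+x. \<integral>\<^sup>+y. f (h(n := (x, y))) \<partial>noise x \<partial>Lam n h \<partial>law n)"
proof -
  have L: "space (law n) = space (hist_space n)" using sets_law by (rule sets_eq_imp_space_eq)
  have "(\<integral>\<^sup>+h. f h \<partial>law (Suc n)) = (\<integral>\<^sup>+h. \<integral>\<^sup>+h'. f h' \<partial>(Lam n h \<bind> (\<lambda>x. noise x \<bind>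
      (\<lambda>y. return (hist_space (Suc n)) (h(n := (x, y)))))) \<partial>law n)"
    unfolding data_law.simps
    using measurable_prob_algebraD[OF step_kernel, of n]
    by (intro nn_integral_bind[OF f]) (simp add: measurable_cong_sets[OF sets_law refl])
  also have "\<dots> = (\<integral>\<^sup>+h. \<integral>\<^sup>+x. \<integral>\<^sup>+y. f (h(n := (x, y))) \<partial>noise x \<partial>Lam n h \<partial>law n)"
  proof (rule nn_integral_cong)
    fix h assume "h \<in> space (law n)"
    then have h[measurable]: "h \<in> space (hist_space n)" by (simp add: L)
    have sL: "sets (Lam n h) = sets borel"
      using measurable_space[OF Lam_kernel h] by (simp add: space_prob_algebra)
    have "(\<lambda>x. noise x \<bind> (\<lambda>y. return (hist_space (Suc n)) (h(n := (x, y)))))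
        \<in> borel \<rightarrow>\<^sub>M prob_algebra (hist_space (Suc n))"
      using h by (intro obs_kernel) auto
    then have "(\<integral>\<^sup>+h'. f h' \<partial>(Lam n h \<bind> (\<lambda>x. noise x \<bind> (\<lambda>y. return (hist_space (Suc n)) (h(n := (x, y)))))))
      = (\<integral>\<^sup>+x. \<integral>\<^sup>+h'. f h' \<partial>(noise x \<bind> (\<lambda>y. return (hist_space (Suc n)) (h(n := (x, y))))) \<partial>Lam n h)"
      by (intro nn_integral_bind[OF f]) (simp add: measurable_cong_sets[OF sL refl] measurable_prob_algebraD)
    also have "\<dots> = (\<integral>\<^sup>+x. \<integral>\<^sup>+y. f (h(n := (x, y))) \<partial>noise x \<partial>Lam n h)"
    proof (rule nn_integral_cong)
      fix x :: "real^'p"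
      have m: "(\<lambda>y. h(n := (x, y))) \<in> borel \<rightarrow>\<^sub>M hist_space (Suc n)"
        using h by (intro measurable_hist_extend) auto
      have "(\<lambda>y. return (hist_space (Suc n)) (h(n := (x, y)))) \<in> noise x \<rightarrow>\<^sub>M subprob_algebra (hist_space (Suc n))"
        using measurable_compose[OF m return_measurable] by simp
      then have "(\<integral>\<^sup>+h'. f h' \<partial>(noise x \<bind> (\<lambda>y. return (hist_space (Suc n)) (h(n := (x, y))))))
        = (\<integral>\<^sup>+y. \<integral>\<^sup>+h'. f h' \<partial>return (hist_space (Suc n)) (h(n := (x, y))) \<partial>noise x)"
        by (rule nn_integral_bind[OF f])
      also have "\<dots> = (\<integral>\<^sup>+y. f (h(n := (x, y))) \<partial>noise x)"
        using measurable_space[OF m] by (intro nn_integral_cong nn_integral_return f) auto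
      finally show "(\<integral>\<^sup>+h'. f h' \<partial>(noise x \<bind> (\<lambda>y. return (hist_space (Suc n)) (h(n := (x, y))))))
        = (\<integral>\<^sup>+y. f (h(n := (x, y))) \<partial>noise x)" .
    qed
    finally show "(\<integral>\<^sup>+h'. f h' \<partial>(Lam n h \<bind> (\<lambda>x. noise x \<bind> (\<lambda>y. return (hist_space (Suc n)) (h(n := (x, y)))))))
      = (\<integral>\<^sup>+x. \<integral>\<^sup>+y. f (h(n := (x, y))) \<partial>noise x \<partial>Lam n h)" .
  qed
  finally show ?thesis .
qed

text \<open>The noise density cancels the denominator and leaves the normal density with mean
  \<open>x \<bullet> b\<close>.\<close>

lemma nn_integral_noise_likelihood_ratio:
  "(\<integral>\<^sup>+y. ennreal (exp (- (y - x \<bullet> b)\<^sup>2 / (2 * sig\<^sup>2)) / exp (- (y - x \<bullet> beta0)\<^sup>2 / (2 * sig\<^sup>2))) \<partial>noise x) = 1"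
proof -
  have "(\<integral>\<^sup>+y. ennreal (exp (- (y - x \<bullet> b)\<^sup>2 / (2 * sig\<^sup>2)) / exp (- (y - x \<bullet> beta0)\<^sup>2 / (2 * sig\<^sup>2))) \<partial>noise x)
    = (\<integral>\<^sup>+y. ennreal (normal_density (x \<bullet> b) sig y) \<partial>lborel)"
    using sigma_pos
    by (subst nn_integral_density) (auto simp: ennreal_mult[symmetric] normal_density_def)
  also have "\<dots> = 1"
    using sigma_pos by (subst nn_integral_eq_integral) auto
  finally show ?thesis .
qed

text \<open>The martingale property. The ratio of the past factors is constant in the new
  observation, and the new factor has conditional mean 1 for every covariate \<open>x\<close>.
  Whatever the adaptive rule picks, averaging over \<open>Lam n h\<close> therefore changes
  nothing.\<close>

lemma nn_integral_likelihood_ratio: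
  "(\<integral>\<^sup>+h. ennreal (lik sig n h b / lik sig n h beta0) \<partial>law n) = 1"
proof (induction n)
  case 0
  then show ?case
    using prob_space.emeasure_space_1[OF prob_space_law[of 0]] by (simp add: lik_def)
next
  case (Suc n)
  have "(\<integral>\<^sup>+h. ennreal (lik sig (Suc n) h b / lik sig (Suc n) h beta0) \<partial>law (Suc n))
    = (\<integral>\<^sup>+h. \<integral>\<^sup>+x. \<integral>\<^sup>+y. ennreal (lik sig n h b / lik sig n h beta0) *
        ennreal (exp (- (y - x \<bullet> b)\<^sup>2 / (2 * sig\<^sup>2)) / exp (- (y - x \<bullet> beta0)\<^sup>2 / (2 * sig\<^sup>2))) \<partial>noise x \<partial>Lam n h \<partial>law n)"
    by (subst nn_integral_law_Suc)
       (simp_all add: lik_extend ennreal_mult[symmetric] lik_pos less_imp_le)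
  also have "\<dots> = (\<integral>\<^sup>+h. \<integral>\<^sup>+x. ennreal (lik sig n h b / lik sig n h beta0) \<partial>Lam n h \<partial>law n)"
    by (subst nn_integral_cmult) (simp_all only: nn_integral_noise_likelihood_ratio mult_1_right, simp_all)
  also have "\<dots> = (\<integral>\<^sup>+h. ennreal (lik sig n h b / lik sig n h beta0) \<partial>law n)"
  proof (rule nn_integral_cong)
    fix h assume "h \<in> space (law n)"
    then have "h \<in> space (hist_space n)" using sets_law by (metis sets_eq_imp_space_eq)
    then have "prob_space (Lam n h)"
      using measurable_space[OF Lam_kernel] by (simp add: space_prob_algebra)
    then show "(\<integral>\<^sup>+x. ennreal (lik sig n h b / lik sig n h beta0) \<partial>Lam n h) = ennreal (lik sig n h b / lik sig n h beta0)"
      by (simp add: prob_space.emeasure_space_1)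
  qed
  finally show ?case using Suc by simp
qed

text \<open>Tonelli lifts the identity from fixed \<open>b\<close> to the mixture. For a prior of
  mass 1 the mixture ratio has expectation 1, as needed for Markov's inequality.\<close>

lemma nn_integral_mixture_likelihood_ratio:
  fixes prior :: "real^'p \<Rightarrow> real"
  assumes [measurable]: "prior \<in> borel_measurable borel" and nn: "\<And>b. prior b \<ge> 0"
  shows "(\<integral>\<^sup>+h. \<integral>\<^sup>+b. ennreal (prior b * (lik sig n h b / lik sig n h beta0)) \<partial>lborel \<partial>law n)
    = (\<integral>\<^sup>+b. ennreal (prior b) \<partial>lborel)"
proof -
  interpret L: prob_space "law n" by (rule prob_space_law)
  interpret pair_sigma_finite "law n" "lborel :: (real^'p) measure" ..
  have "(\<integral>\<^sup>+h. \<integral>\<^sup>+b. ennreal (prior b * (lik sig n h b / lik sig n h beta0)) \<partial>lborel \<partial>law n)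
      = (\<integral>\<^sup>+b. \<integral>\<^sup>+h. ennreal (prior b * (lik sig n h b / lik sig n h beta0)) \<partial>law n \<partial>lborel)"
    by (rule Fubini'[symmetric]) measurable
  also have "\<dots> = (\<integral>\<^sup>+b. ennreal (prior b) * (\<integral>\<^sup>+h. ennreal (lik sig n h b / lik sig n h beta0) \<partial>law n) \<partial>lborel)"
    by (subst nn_integral_cmult[symmetric])
       (auto simp: ennreal_mult[symmetric] nn lik_pos less_imp_le)
  finally show ?thesis by (simp add: nn_integral_likelihood_ratio)
qed

end

section \<open>Total variation distance of a reweighted Gaussian\<close>

lemma measure_density_real:
  assumes "integrable M f" "\<And>x. f x \<ge> 0" "A \<in> sets M"
  shows "measure (density M (\<lambda>x. ennreal (f x))) A = (\<integral>x. f x * indicator A x \<partial>M)"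
proof -
  have "emeasure (density M (\<lambda>x. ennreal (f x))) A = (\<integral>\<^sup>+x. ennreal (f x * indicator A x) \<partial>M)"
    using assms by (subst emeasure_density) (auto intro!: nn_integral_cong simp: indicator_def)
  also have "\<dots> = ennreal (\<integral>x. f x * indicator A x \<partial>M)"
    using assms by (intro nn_integral_eq_integral integrable_real_mult_indicator) auto
  finally show ?thesis
    using assms by (simp add: measure_def integral_nonneg_AE)
qed

text \<open>The normaliser \<open>m\<close> differs from \<open>g0\<close> by at most the mean
  deviation \<open>I\<close>, so replacing both \<open>g\<close> and \<open>m\<close> by
  \<open>g0\<close> costs at most \<open>2 * I / m\<close> in L1 norm; \<open>eta < g0\<close> keeps
  \<open>m\<close> away from 0.\<close>

lemma tv_dist_reweighted_le:
  fixes g phi :: "'a \<Rightarrow> real" and g0 eta :: real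
  assumes phi: "integrable M phi" "\<And>x. phi x \<ge> 0" "(\<integral>x. phi x \<partial>M) = 1"
    and g: "\<And>x. g x \<ge> 0" "g \<in> borel_measurable M"
    and dev: "integrable M (\<lambda>x. \<bar>g x - g0\<bar> * phi x)" "(\<integral>x. \<bar>g x - g0\<bar> * phi x \<partial>M) \<le> eta"
    and eta: "eta < g0"
  shows "tv_dist (density M (\<lambda>x. ennreal (g x * phi x / (\<integral>y. g y * phi y \<partial>M))))
      (density M (\<lambda>x. ennreal (phi x))) \<le> 2 * eta / (g0 - eta)"
proof -
  define m where "m = (\<integral>y. g y * phi y \<partial>M)"
  define I where "I = (\<integral>x. \<bar>g x - g0\<bar> * phi x \<partial>M)"
  note [measurable] = g(2) borel_measurable_integrable[OF phi(1)]
  have dev': "integrable M (\<lambda>x. (g x - g0) * phi x)"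
    using phi(2) by (intro Bochner_Integration.integrable_bound[OF dev(1)]) (auto simp: abs_mult)
  \<comment> \<open>Integrability of \<open>g x * phi x\<close> is recovered from that of the
    deviation by adding back \<open>g0 * phi x\<close>.\<close>
  have "integrable M (\<lambda>x. (g x - g0) * phi x + g0 * phi x)"
    using dev' phi(1) by (intro Bochner_Integration.integrable_add) auto
  then have gphi: "integrable M (\<lambda>x. g x * phi x)" by (simp add: algebra_simps)
  have "m - g0 = (\<integral>x. (g x - g0) * phi x \<partial>M)"
    using gphi phi by (simp add: m_def left_diff_distrib)
  also have "\<bar>\<dots>\<bar> \<le> (\<integral>x. \<bar>(g x - g0) * phi x\<bar> \<partial>M)" by (rule integral_abs_bound)
  also have "\<dots> = I" using phi(2) by (simp add: I_def abs_mult)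
  finally have mg: "\<bar>m - g0\<bar> \<le> I" .
  have I: "I \<le> eta" using dev(2) by (simp add: I_def)
  have m: "m \<ge> g0 - eta" "m > 0" using mg I eta by linarith+
  have I0: "I \<ge> 0" using phi(2) unfolding I_def by (intro integral_nonneg_AE) auto
  have int1: "integrable M (\<lambda>x. g x * phi x / m)" using gphi by simp
  have dom: "\<bar>g x * phi x / m - phi x\<bar> \<le> (\<bar>g x - g0\<bar> * phi x + I * phi x) / m" for x
  proof -
    have "g x * phi x / m - phi x = ((g x - g0) * phi x + (g0 - m) * phi x) / m"
      using m by (simp add: field_simps)
    also have "\<bar>\<dots>\<bar> \<le> (\<bar>g x - g0\<bar> * phi x + \<bar>g0 - m\<bar> * phi x) / m"
      using m phi(2)[of x] abs_triangle_ineq[of "(g x - g0) * phi x" "(g0 - m) * phi x"]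
      by (simp add: abs_mult divide_right_mono)
    also have "\<dots> \<le> (\<bar>g x - g0\<bar> * phi x + I * phi x) / m"
      using m phi(2)[of x] mg by (intro divide_right_mono add_left_mono mult_right_mono) auto
    finally show ?thesis .
  qed
  have "\<bar>measure (density M (\<lambda>x. ennreal (g x * phi x / m))) A - measure (density M (\<lambda>x. ennreal (phi x))) A\<bar>
      \<le> 2 * eta / (g0 - eta)" if A: "A \<in> sets M" for A
  proof -
    have "measure (density M (\<lambda>x. ennreal (g x * phi x / m))) A - measure (density M (\<lambda>x. ennreal (phi x))) A
        = (\<integral>x. (g x * phi x / m) * indicator A x \<partial>M) - (\<integral>x. phi x * indicator A x \<partial>M)"
      using int1 phi g m A by (subst (1 2) measure_density_real) auto
    also have "\<dots> = (\<integral>x. (g x * phi x / m - phi x) * indicator A x \<partial>M)"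
      using int1 phi(1) A
      by (simp add: left_diff_distrib integrable_real_mult_indicator del: times_divide_eq_left)
    also have "\<bar>\<dots>\<bar> \<le> (\<integral>x. \<bar>(g x * phi x / m - phi x) * indicator A x\<bar> \<partial>M)" by (rule integral_abs_bound)
    also have "\<dots> \<le> (\<integral>x. (\<bar>g x - g0\<bar> * phi x + I * phi x) / m \<partial>M)"
    proof (rule integral_mono')
      show "integrable M (\<lambda>x. (\<bar>g x - g0\<bar> * phi x + I * phi x) / m)"
        using dev(1) phi(1) by simp
      show "\<bar>(g x * phi x / m - phi x) * indicator A x\<bar> \<le> (\<bar>g x - g0\<bar> * phi x + I * phi x) / m" for x
        using dom[of x] m phi(2)[of x] I0 by (cases "x \<in> A") auto
    qed (use m phi(2) I0 in auto)
    also have "\<dots> = 2 * I / m"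
      using dev(1) phi by (simp add: I_def)
    also have "\<dots> \<le> 2 * eta / (g0 - eta)"
      using I I0 m eta by (intro frac_le) auto
    finally show ?thesis .
  qed
  then show ?thesis
    unfolding tv_dist_def m_def[symmetric] by (intro cSUP_least) auto
qed

text \<open>For positive definite \<open>A\<close>, the normal density with mean \<open>m\<close>
  and covariance \<open>s\<^sup>2 *\<^sub>R matrix_inv A\<close>, parametrised by precision so that
  the Gram matrix enters without inversion.\<close>

definition gauss_density :: "real^'p^'p \<Rightarrow> real^'p \<Rightarrow> real \<Rightarrow> real^'p \<Rightarrow> real" where
  "gauss_density A m s b =
    exp (- (1 / (2 * s\<^sup>2)) * ((b - m) \<bullet> (A *v (b - m)))) / sqrt ((2 * pi * s\<^sup>2) ^ CARD('p) / det A)"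

lemma gauss_density_nonneg: "det A > 0 \<Longrightarrow> gauss_density A m s b \<ge> 0"
  by (simp add: gauss_density_def)

lemma borel_measurable_gauss_density[measurable]: "gauss_density A m s \<in> borel_measurable borel"
  unfolding gauss_density_def[abs_def] by measurable

lemma has_bochner_integral_gaussian_quadratic_form:
  fixes A :: "real^'n^'n"
  assumes sym: "transpose A = A" and pos: "lambda_min A > 0" and c: "c > 0"
  shows "has_bochner_integral lborel (\<lambda>x. exp (- c * ((x - m) \<bullet> (A *v (x - m)))))
    (sqrt ((pi / c) ^ CARD('n) / det A))"
proof (rule has_bochner_integral_nn_integral)
  have "(\<integral>\<^sup>+x. ennreal (exp (- c * ((x - m) \<bullet> (A *v (x - m))))) \<partial>lborel)
      = (\<integral>\<^sup>+x. ennreal (exp (- c * (x \<bullet> (A *v x)))) \<partial>lborel)"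
    using nn_integral_lborel_translate[of "\<lambda>x. ennreal (exp (- c * (x \<bullet> (A *v x))))" "- m"] by simp
  then show "(\<integral>\<^sup>+x. ennreal (exp (- c * ((x - m) \<bullet> (A *v (x - m))))) \<partial>lborel)
      = ennreal (sqrt ((pi / c) ^ CARD('n) / det A))"
    by (simp only: nn_integral_gaussian_quadratic_form[OF sym pos c])
qed (use c det_pos_if_lambda_min_pos[OF sym pos] in \<open>auto simp: zero_le_divide_iff\<close>)

lemma has_bochner_integral_gauss_density:
  fixes A :: "real^'n^'n"
  assumes sym: "transpose A = A" and pos: "lambda_min A > 0" and s: "s > 0"
  shows "has_bochner_integral lborel (gauss_density A m s) 1"
proof -
  have c: "1 / (2 * s\<^sup>2) > 0" "pi / (1 / (2 * s\<^sup>2)) = 2 * pi * s\<^sup>2" using s by auto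
  have "(2 * pi * s\<^sup>2) ^ CARD('n) / det A > 0"
    using s det_pos_if_lambda_min_pos[OF sym pos] by simp
  with has_bochner_integral_divide_zero[OF has_bochner_integral_gaussian_quadratic_form[OF sym pos c(1), of m],
      of "sqrt ((2 * pi * s\<^sup>2) ^ CARD('n) / det A)"]
  show ?thesis unfolding gauss_density_def[abs_def] c(2)
    using s det_pos_if_lambda_min_pos[OF sym pos] by simp
qed

text \<open>The smallest eigenvalue bounds the exponent, and the determinant bound controls the
  normaliser. A pointwise estimate is wanted because the prior may be unbounded: far from
  \<open>m\<close> the prior is integrated against this supremum.\<close>

lemma gauss_density_tail_le:
  fixes A :: "real^'n^'n"
  assumes sym: "transpose A = A" and pos: "lambda_min A > 0" and s: "s > 0"
    and b: "norm (b - m) \<ge> d" and d: "d \<ge> 0"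
  shows "gauss_density A m s b
    \<le> sqrt (lambda_max A ^ CARD('n)) / sqrt ((2 * pi * s\<^sup>2) ^ CARD('n)) * exp (- lambda_min A * d\<^sup>2 / (2 * s\<^sup>2))"
proof -
  have "lambda_min A * d\<^sup>2 \<le> lambda_min A * (norm (b - m))\<^sup>2"
    using pos b d by (intro mult_left_mono power_mono) auto
  also have "\<dots> \<le> (b - m) \<bullet> (A *v (b - m))" by (rule lambda_min_le_quadratic_form[OF sym])
  finally have "exp (- (1 / (2 * s\<^sup>2)) * ((b - m) \<bullet> (A *v (b - m)))) \<le> exp (- lambda_min A * d\<^sup>2 / (2 * s\<^sup>2))"
    using s by (simp add: divide_right_mono)
  moreover have "sqrt (det A) \<le> sqrt (lambda_max A ^ CARD('n))"
    using det_le_lambda_max_power[OF sym pos] by simp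
  ultimately have "sqrt (det A) * exp (- (1 / (2 * s\<^sup>2)) * ((b - m) \<bullet> (A *v (b - m))))
      \<le> sqrt (lambda_max A ^ CARD('n)) * exp (- lambda_min A * d\<^sup>2 / (2 * s\<^sup>2))"
    using det_pos_if_lambda_min_pos[OF sym pos] by (intro mult_mono) auto
  from divide_right_mono[OF this, of "sqrt ((2 * pi * s\<^sup>2) ^ CARD('n))"] s
  show ?thesis by (simp add: gauss_density_def real_sqrt_divide mult.commute)
qed

text \<open>Half of the exponent pays for the exponential factor. The other half is a Gaussian
  kernel with doubled covariance, whose integral is the original normaliser times
  \<open>sqrt (2 ^ CARD('n))\<close>; no power of \<open>lambda_max A\<close> appears.\<close>

lemma gauss_density_tail_mass_le:
  fixes A :: "real^'n^'n"
  assumes sym: "transpose A = A" and pos: "lambda_min A > 0" and s: "s > 0" and d: "d \<ge> 0"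
  shows "(\<integral>b. gauss_density A m s b * indicator {b. norm (b - m) \<ge> d} b \<partial>lborel)
    \<le> sqrt (2 ^ CARD('n)) * exp (- lambda_min A * d\<^sup>2 / (4 * s\<^sup>2))"
proof -
  let ?q = "\<lambda>b. (b - m) \<bullet> (A *v (b - m))"
  \<comment> \<open>\<open>?N 2\<close> normalises the density and \<open>?N 4\<close> is the
    integral of the kernel with halved exponent.\<close>
  let ?N = "\<lambda>k. sqrt ((k * pi * s\<^sup>2) ^ CARD('n) / det A)"
  have det: "det A > 0" by (rule det_pos_if_lambda_min_pos[OF sym pos])
  have c: "1 / (4 * s\<^sup>2) > 0" "pi / (1 / (4 * s\<^sup>2)) = 4 * pi * s\<^sup>2" using s by auto
  have hb: "has_bochner_integral lborel (\<lambda>b. exp (- lambda_min A * d\<^sup>2 / (4 * s\<^sup>2)) / ?N 2 * exp (- (1 / (4 * s\<^sup>2)) * ?q b))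
      (exp (- lambda_min A * d\<^sup>2 / (4 * s\<^sup>2)) / ?N 2 * ?N 4)"
    using has_bochner_integral_gaussian_quadratic_form[OF sym pos c(1), of m] unfolding c(2)
    by (rule has_bochner_integral_mult_right[rotated])
  have "(\<integral>b. gauss_density A m s b * indicator {b. norm (b - m) \<ge> d} b \<partial>lborel)
      \<le> (\<integral>b. exp (- lambda_min A * d\<^sup>2 / (4 * s\<^sup>2)) / ?N 2 * exp (- (1 / (4 * s\<^sup>2)) * ?q b) \<partial>lborel)"
  proof (rule integral_mono')
    show "integrable lborel (\<lambda>b. exp (- lambda_min A * d\<^sup>2 / (4 * s\<^sup>2)) / ?N 2 * exp (- (1 / (4 * s\<^sup>2)) * ?q b))"
      using hb by (simp only: has_bochner_integral_iff)
    show "gauss_density A m s b * indicator {b. norm (b - m) \<ge> d} b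
        \<le> exp (- lambda_min A * d\<^sup>2 / (4 * s\<^sup>2)) / ?N 2 * exp (- (1 / (4 * s\<^sup>2)) * ?q b)" for b
    proof (cases "norm (b - m) \<ge> d")
      case True
      have "lambda_min A * d\<^sup>2 \<le> lambda_min A * (norm (b - m))\<^sup>2"
        using pos True d by (intro mult_left_mono power_mono) auto
      also have "\<dots> \<le> ?q b" by (rule lambda_min_le_quadratic_form[OF sym])
      finally have "- (1 / (2 * s\<^sup>2)) * ?q b \<le> - lambda_min A * d\<^sup>2 / (4 * s\<^sup>2) + - (1 / (4 * s\<^sup>2)) * ?q b"
        using s by (simp add: field_simps)
      then have "exp (- (1 / (2 * s\<^sup>2)) * ?q b)
          \<le> exp (- lambda_min A * d\<^sup>2 / (4 * s\<^sup>2)) * exp (- (1 / (4 * s\<^sup>2)) * ?q b)"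
        unfolding exp_add[symmetric] by (simp only: exp_le_cancel_iff)
      from divide_right_mono[OF this, of "?N 2"] det True show ?thesis
        by (simp add: gauss_density_def)
    qed (use det in auto)
    show "0 \<le> exp (- lambda_min A * d\<^sup>2 / (4 * s\<^sup>2)) / ?N 2 * exp (- (1 / (4 * s\<^sup>2)) * ?q b)" for b
      using det by auto
  qed
  also have "\<dots> = exp (- lambda_min A * d\<^sup>2 / (4 * s\<^sup>2)) / ?N 2 * ?N 4"
    using hb by (rule has_bochner_integral_integral_eq)
  also have "?N 4 = sqrt (2 ^ CARD('n)) * ?N 2"
  proof -
    have "4 * pi * s\<^sup>2 = 2 * (2 * pi * s\<^sup>2)" by simp
    then have "(4 * pi * s\<^sup>2) ^ CARD('n) = 2 ^ CARD('n) * (2 * pi * s\<^sup>2) ^ CARD('n)"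
      by (simp only: power_mult_distrib)
    then show ?thesis by (simp add: real_sqrt_mult[symmetric])
  qed
  also have "exp (- lambda_min A * d\<^sup>2 / (4 * s\<^sup>2)) / ?N 2 * (sqrt (2 ^ CARD('n)) * ?N 2)
      = sqrt (2 ^ CARD('n)) * exp (- lambda_min A * d\<^sup>2 / (4 * s\<^sup>2))"
    using det s by simp
  finally show ?thesis .
qed

section \<open>Posterior and normal limit as Gaussian densities\<close>

lemma mvn_eq_gauss_density:
  fixes A :: "real^'n^'n"
  assumes det: "det A > 0" and s: "s > 0"
  shows "mvn m (s\<^sup>2 *\<^sub>R matrix_inv A) = density lborel (\<lambda>b. ennreal (gauss_density A m s b))"
proof -
  have cancel: "A ** matrix_inv A = mat 1" using det by (intro matrix_inv_cancel) simp
  have "((1 / s\<^sup>2) *\<^sub>R A) ** (s\<^sup>2 *\<^sub>R matrix_inv A) = mat 1"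
    using s by (simp add: scalar_matrix_assoc[symmetric] matrix_scalar_ac cancel)
  then have inv: "matrix_inv (s\<^sup>2 *\<^sub>R matrix_inv A) = (1 / s\<^sup>2) *\<^sub>R A" by (rule matrix_inv_eqI)
  have "det A * det (matrix_inv A) = 1"
    using cancel by (metis det_I det_mul)
  then have d: "(2 * pi) ^ CARD('n) * det (s\<^sup>2 *\<^sub>R matrix_inv A) = (2 * pi * s\<^sup>2) ^ CARD('n) / det A"
    using det by (simp add: det_scaleR power_mult_distrib field_simps)
  show ?thesis
    unfolding mvn_def gauss_density_def inv d
    by (simp add: scaleR_matrix_vector_assoc[symmetric])
qed

lemma posterior_eq_reweighted_gauss_density:
  assumes det: "det (gram n h) > 0" and s: "sig > 0"
  shows "posterior prior sig n h = density lborel (\<lambda>b. ennreal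
    (prior b * gauss_density (gram n h) (beta_hat n h) sig b
      / (\<integral>c. prior c * gauss_density (gram n h) (beta_hat n h) sig c \<partial>lborel)))"
proof -
  let ?phi = "gauss_density (gram n h) (beta_hat n h) sig"
  define k where "k = lik sig n h (beta_hat n h) * sqrt ((2 * pi * sig\<^sup>2) ^ CARD('a) / det (gram n h))"
  have k: "k > 0" using det s by (simp add: k_def lik_eq_exp_sum)
  have "sqrt ((2 * pi * sig\<^sup>2) ^ CARD('a) / det (gram n h)) > 0" using det s by simp
  then have lik: "lik sig n h b = k * ?phi b" for b
    using det s by (subst lik_gaussian) (simp_all add: k_def gauss_density_def)
  have "(\<integral>c. prior c * lik sig n h c \<partial>lborel) = k * (\<integral>c. prior c * ?phi c \<partial>lborel)"
    unfolding lik by (simp only: mult.left_commute[of _ k] integral_mult_right_zero)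
  then show ?thesis
    unfolding posterior_def lik using k by (simp add: mult.left_commute[of _ k])
qed

text \<open>Split at distance \<open>d\<close> from \<open>m\<close>. Inside, the hypothesis
  \<open>near\<close> applies. Outside, the deviation is at most \<open>g b + g0\<close>: the first
  part is handled by the supremum \<open>C\<close> of the density and the unit mass of
  \<open>g\<close>, the second by the Gaussian tail mass.\<close>

lemma prior_deviation_le:
  fixes A :: "real^'n^'n" and g :: "real^'n \<Rightarrow> real"
  assumes sym: "transpose A = A" and pos: "lambda_min A > 0" and s: "s > 0" and d: "d \<ge> 0"
    and g: "\<And>b. g b \<ge> 0" "integrable lborel g" "(\<integral>b. g b \<partial>lborel) = 1"
    and g0: "g0 \<ge> 0" and eps: "eps \<ge> 0" 
    and near: "\<And>b. norm (b - m) < d \<Longrightarrow> \<bar>g b - g0\<bar> \<le> eps * g0"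
  defines "C \<equiv> sqrt (lambda_max A ^ CARD('n)) / sqrt ((2 * pi * s\<^sup>2) ^ CARD('n)) * exp (- lambda_min A * d\<^sup>2 / (2 * s\<^sup>2))"
  shows "integrable lborel (\<lambda>b. \<bar>g b - g0\<bar> * gauss_density A m s b)"
    and "(\<integral>b. \<bar>g b - g0\<bar> * gauss_density A m s b \<partial>lborel)
      \<le> eps * g0 + C + g0 * (sqrt (2 ^ CARD('n)) * exp (- lambda_min A * d\<^sup>2 / (4 * s\<^sup>2)))"
proof -
  let ?phi = "gauss_density A m s"
  let ?T = "indicator {b. norm (b - m) \<ge> d} :: real^'n \<Rightarrow> real"
  have det: "det A > 0" by (rule det_pos_if_lambda_min_pos[OF sym pos])
  note phi0 = gauss_density_nonneg[OF det, of m s]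
  have iphi: "integrable lborel ?phi" "(\<integral>b. ?phi b \<partial>lborel) = 1"
    using has_bochner_integral_gauss_density[OF sym pos s, of m]
    by (auto simp: has_bochner_integral_iff)
  have iT: "integrable lborel (\<lambda>b. ?phi b * ?T b)"
    using iphi(1) by (rule integrable_real_mult_indicator[rotated]) simp
  let ?R = "\<lambda>b. eps * g0 * ?phi b + C * g b + g0 * (?phi b * ?T b)"
  have iR: "integrable lborel ?R"
    using iphi iT g(2) by (intro Bochner_Integration.integrable_add) auto
  have Lam: "lambda_max A > 0" using pos lambda_min_le_lambda_max[OF sym] by linarith
  have C: "C \<ge> 0" using s Lam by (simp add: C_def)
  have dom: "\<bar>g b - g0\<bar> * ?phi b \<le> ?R b" for b
  proof (cases "norm (b - m) < d")
    case True
    have "\<bar>g b - g0\<bar> * ?phi b \<le> eps * g0 * ?phi b"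
      using near[OF True] phi0 by (rule mult_right_mono)
    also have "\<dots> \<le> ?R b" using C g(1)[of b] g0 phi0[of b] by simp
    finally show ?thesis .
  next
    case False
    have "\<bar>g b - g0\<bar> * ?phi b \<le> (g b + g0) * ?phi b"
      using g(1)[of b] g0 phi0[of b] by (intro mult_right_mono) auto
    also have "\<dots> = ?phi b * g b + g0 * (?phi b * ?T b)" using False by (simp add: algebra_simps)
    also have "\<dots> \<le> C * g b + g0 * (?phi b * ?T b)"
      unfolding C_def using gauss_density_tail_le[OF sym pos s _ d, of b m] False g(1)[of b]
      by (intro add_right_mono mult_right_mono) auto
    also have "\<dots> \<le> ?R b" using eps g0 phi0[of b] by simp
    finally show ?thesis .
  qed
  have R0: "0 \<le> \<bar>g b - g0\<bar> * ?phi b" for b using phi0[of b] by simp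
  note [measurable] = borel_measurable_integrable[OF g(2)]
  show "integrable lborel (\<lambda>b. \<bar>g b - g0\<bar> * ?phi b)"
  proof (rule Bochner_Integration.integrable_bound[OF iR])
    show "AE b in lborel. norm (\<bar>g b - g0\<bar> * ?phi b) \<le> norm (?R b)"
      using dom R0 by (intro AE_I2) (simp add: order_trans[OF _ abs_ge_self])
  qed measurable
  have "(\<integral>b. \<bar>g b - g0\<bar> * ?phi b \<partial>lborel) \<le> (\<integral>b. ?R b \<partial>lborel)"
    using iR dom order_trans[OF R0 dom] by (rule integral_mono')
  also have "\<dots> = eps * g0 + C + g0 * (\<integral>b. ?phi b * ?T b \<partial>lborel)"
    using iphi iT g(2,3) by (simp add: Bochner_Integration.integral_add)
  also have "\<dots> \<le> eps * g0 + C + g0 * (sqrt (2 ^ CARD('n)) * exp (- lambda_min A * d\<^sup>2 / (4 * s\<^sup>2)))"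
    using gauss_density_tail_mass_le[OF sym pos s d] g0 by (intro add_left_mono mult_left_mono) auto
  finally show "(\<integral>b. \<bar>g b - g0\<bar> * ?phi b \<partial>lborel)
      \<le> eps * g0 + C + g0 * (sqrt (2 ^ CARD('n)) * exp (- lambda_min A * d\<^sup>2 / (4 * s\<^sup>2)))" .
qed

section \<open>Consistency of the least squares estimate\<close>

text \<open>The seminorm induced by the Gram matrix, that is, the length of the design matrix
  applied to \<open>v\<close>. Writing it with \<open>L2_set\<close> supplies the triangle
  inequality.\<close>

definition design_norm :: "nat \<Rightarrow> ('p::finite) hist \<Rightarrow> real^'p \<Rightarrow> real" where
  "design_norm n h v = L2_set (\<lambda>j. fst (h j) \<bullet> v) {..<n}"

lemma design_norm_power2: "(design_norm n h v)\<^sup>2 = v \<bullet> (gram n h *v v)"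
  by (simp add: design_norm_def L2_set_def gram_quadratic_form sum_nonneg)

lemma design_norm_nonneg: "design_norm n h v \<ge> 0"
  by (simp add: design_norm_def)

lemma design_norm_triangle: "design_norm n h (v + w) \<le> design_norm n h v + design_norm n h w"
  by (simp add: design_norm_def inner_add_right L2_set_triangle_ineq)

lemma design_norm_scaleR: "design_norm n h (c *\<^sub>R v) = \<bar>c\<bar> * design_norm n h v"
proof (rule power2_eq_imp_eq)
  show "(design_norm n h (c *\<^sub>R v))\<^sup>2 = (\<bar>c\<bar> * design_norm n h v)\<^sup>2"
    unfolding design_norm_power2 power_mult_distrib
    by (simp add: matrix_vector_mult_scaleR power2_eq_square)
qed (simp_all add: design_norm_nonneg)

text \<open>Here \<open>beta0 + t *\<^sub>R D\<close> is the point at distance \<open>d\<close> from \<open>beta0\<close> on the segment towards the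
  least squares estimate. On a ball of radius \<open>1 / sqrt (lambda_max A)\<close> the design norm varies by
  at most 1, so the ratio is large on a set whose volume is only polynomially small in \<open>lambda_max A\<close>.\<close>

lemma likelihood_ratio_near_segment:
  fixes h :: "('p::finite) hist" and beta0 :: "real^'p" and n :: nat and d t :: real
  defines "A \<equiv> gram n h" and "D \<equiv> beta_hat n h - beta0"
  assumes pos: "lambda_min A > 0" and s: "sig > 0" and d: "d > 0" "4 \<le> lambda_min A * d\<^sup>2"
    and D: "norm D \<ge> d" and t: "t = d / norm D"
    and b: "norm (b - (beta0 + t *\<^sub>R D)) \<le> 1 / sqrt (lambda_max A)"
  shows "lik sig n h b / lik sig n h beta0 \<ge> exp (lambda_min A * d\<^sup>2 / (4 * sig\<^sup>2))"
proof -
  have sym: "transpose A = A" unfolding A_def by (rule transpose_gram)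
  have det: "det (gram n h) \<noteq> 0" using det_pos_if_lambda_min_pos[OF sym pos] by (simp add: A_def)
  have Lam: "lambda_max A > 0" using pos lambda_min_le_lambda_max[OF sym] by linarith
  have t01: "0 < t" "t \<le> 1" using d(1) D by (auto simp: t divide_simps)
  let ?N = "design_norm n h"
  define S where "S = ?N D"
  define u where "u = b - (beta0 + t *\<^sub>R D)"
  have "(?N u)\<^sup>2 \<le> lambda_max A * (norm u)\<^sup>2"
    using quadratic_form_le_lambda_max[OF sym, of u] by (simp add: design_norm_power2 A_def)
  also have "\<dots> \<le> lambda_max A * (1 / sqrt (lambda_max A))\<^sup>2"
    using b Lam by (intro mult_left_mono power_mono) (auto simp: u_def)
  also have "\<dots> = 1" using Lam by (simp add: power_divide)
  finally have Nu: "?N u \<le> 1"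
    using design_norm_nonneg by (simp add: power2_le_iff_abs_le abs_square_le_1)
  \<comment> \<open>From the segment point a fraction \<open>1 - t\<close> of \<open>D\<close> is
    left to the estimate, and \<open>u\<close> adds design norm at most 1.\<close>
  have "b - beta_hat n h = u + (t - 1) *\<^sub>R D"
    by (simp add: u_def D_def algebra_simps)
  then have Nb: "?N (b - beta_hat n h) \<le> 1 + (1 - t) * S"
    using design_norm_triangle[of n h u "(t - 1) *\<^sub>R D"] Nu t01 by (simp add: design_norm_scaleR S_def)
  have "lambda_min A * d\<^sup>2 = lambda_min A * (norm (t *\<^sub>R D))\<^sup>2"
  proof -
    have "norm D > 0" using d(1) D by linarith
    then show ?thesis using d(1) by (simp add: t)
  qed
  also have "\<dots> \<le> (?N (t *\<^sub>R D))\<^sup>2"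
    using lambda_min_le_quadratic_form[OF sym, of "t *\<^sub>R D"] by (simp add: design_norm_power2 A_def)
  also have "\<dots> = (t * S)\<^sup>2" using t01 by (simp add: design_norm_scaleR S_def)
  finally have tS: "lambda_min A * d\<^sup>2 \<le> (t * S)\<^sup>2" .
  have S0: "S \<ge> 0" by (simp add: S_def design_norm_nonneg)
  have "2\<^sup>2 \<le> (t * S)\<^sup>2" using tS d(2) by simp
  then have tS2: "2 \<le> t * S" by (rule power2_le_imp_le) (use S0 t01 in simp)
  have tSS: "t * S \<le> S" using t01 S0 by (simp add: mult_left_le_one_le)
  \<comment> \<open>The aim is the factored difference of squares
    \<open>(t * S - 1) * ((2 - t) * S + 1)\<close>. Since \<open>t * S\<close> is at least 2, the
    first factor is at least \<open>t * S / 2\<close>; this loss of a half is why the final exponent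
    is divided by 4.\<close>
  have "(t * S)\<^sup>2 / 2 = (t * S / 2) * (t * S)" by (simp add: power2_eq_square)
  also have "\<dots> \<le> (t * S - 1) * ((2 - t) * S + 1)"
  proof (rule mult_mono)
    have "(2 - t) * S = S + (S - t * S)" by (simp add: algebra_simps)
    then show "t * S \<le> (2 - t) * S + 1" using tSS S0 by linarith
  qed (use tS2 in linarith)+
  also have "\<dots> = S\<^sup>2 - (1 + (1 - t) * S)\<^sup>2" by (simp add: power2_eq_square algebra_simps)
  also have "\<dots> \<le> S\<^sup>2 - (?N (b - beta_hat n h))\<^sup>2"
    using Nb design_norm_nonneg by (intro diff_left_mono power_mono)
  finally have key: "lambda_min A * d\<^sup>2 / 2 \<le> S\<^sup>2 - (?N (b - beta_hat n h))\<^sup>2"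
    using tS by simp
  have "?N (beta0 - beta_hat n h) = S"
    using design_norm_scaleR[of n h "-1" D] by (simp add: S_def D_def)
  then have 0: "(beta0 - beta_hat n h) \<bullet> (gram n h *v (beta0 - beta_hat n h)) = S\<^sup>2"
    using design_norm_power2 by metis
  have "lik sig n h b / lik sig n h beta0 = exp (- (1 / (2 * sig\<^sup>2)) * (?N (b - beta_hat n h))\<^sup>2)
      / exp (- (1 / (2 * sig\<^sup>2)) * S\<^sup>2)"
    unfolding lik_gaussian[OF det, of sig b] lik_gaussian[OF det, of sig beta0] 0 design_norm_power2
    by (simp add: lik_eq_exp_sum)
  also have "\<dots> = exp ((S\<^sup>2 - (?N (b - beta_hat n h))\<^sup>2) / (2 * sig\<^sup>2))"
    by (simp add: exp_diff[symmetric] diff_divide_distrib)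
  also have "\<dots> \<ge> exp (lambda_min A * d\<^sup>2 / (4 * sig\<^sup>2))"
    using divide_right_mono[OF key, of "2 * sig\<^sup>2"] s by simp
  finally show ?thesis .
qed

text \<open>Only the ball of radius \<open>r\<close> about the segment point \<open>z\<close> is
  kept. There the ratio is exponentially large, and \<open>r \<le> d\<close> keeps the ball within
  \<open>2 * d\<close> of \<open>beta0\<close>, where \<open>g\<close> is at least \<open>c\<close>.
  The volume of the ball supplies the power of \<open>lambda_max A\<close>.\<close>

lemma mixture_likelihood_ratio_ge:
  fixes h :: "('p::finite) hist" and n :: nat and g :: "real^'p \<Rightarrow> real"
  defines "A \<equiv> gram n h"
  assumes pos: "lambda_min A > 0" and s: "sig > 0" and d: "d > 0" "4 \<le> lambda_min A * d\<^sup>2"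
    and D: "norm (beta_hat n h - beta0) \<ge> d"
    and c: "c \<ge> 0" "\<And>b. norm (b - beta0) < 2 * d \<Longrightarrow> g b \<ge> c"
  shows "(\<integral>\<^sup>+b. ennreal (g b * (lik sig n h b / lik sig n h beta0)) \<partial>lborel)
    \<ge> ennreal (c * exp (lambda_min A * d\<^sup>2 / (4 * sig\<^sup>2)) *
        (measure lborel (ball (0 :: real^'p) 1) / sqrt (lambda_max A ^ CARD('p))))"
proof -
  define D where "D = beta_hat n h - beta0"
  define z where "z = beta0 + (d / norm D) *\<^sub>R D"
  define r where "r = 1 / sqrt (lambda_max A)"
  define E where "E = exp (lambda_min A * d\<^sup>2 / (4 * sig\<^sup>2))"
  have le: "lambda_min A \<le> lambda_max A"
    unfolding A_def by (rule lambda_min_le_lambda_max[OF transpose_gram])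
  then have Lam: "lambda_max A > 0" using pos by linarith
  have r0: "r > 0" using Lam by (simp add: r_def)
  have "r \<le> d"
  proof -
    have "1 \<le> lambda_max A * d\<^sup>2"
      using d(2) mult_right_mono[OF le, of "d\<^sup>2"] by simp
    then have "r\<^sup>2 \<le> d\<^sup>2" using Lam by (simp add: r_def power_divide field_simps)
    then show ?thesis by (rule power2_le_imp_le[OF _ less_imp_le[OF d(1)]])
  qed
  have zb: "norm (z - beta0) = d" using d(1) assms(6) by (auto simp: z_def D_def)
  have dom: "ennreal (c * E) * indicator (ball z r) b \<le> ennreal (g b * (lik sig n h b / lik sig n h beta0))" for b
  proof (cases "b \<in> ball z r")
    case True
    then have bz: "norm (b - z) < r" by (simp add: dist_norm norm_minus_commute)
    have "norm (b - beta0) < 2 * d"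
      using norm_triangle_ineq[of "b - z" "z - beta0"] bz zb \<open>r \<le> d\<close> by simp
    then have "g b \<ge> c" by (rule c(2))
    moreover have "lik sig n h b / lik sig n h beta0 \<ge> E"
      unfolding E_def A_def
      by (rule likelihood_ratio_near_segment[OF _ s d(1) _ _ refl])
         (use pos d D bz in \<open>auto simp: A_def z_def r_def D_def\<close>)
    ultimately have "c * E \<le> g b * (lik sig n h b / lik sig n h beta0)"
      using c(1) by (intro mult_mono) (auto simp: E_def)
    then show ?thesis using True by (simp add: ennreal_leI)
  qed simp
  have "measure lborel (ball z r) = r ^ CARD('p) * measure lborel (ball (0 :: real^'p) 1)"
    using content_ball_conv_unit_ball[of r z] r0 by simp
  also have "\<dots> = measure lborel (ball (0 :: real^'p) 1) / sqrt (lambda_max A ^ CARD('p))"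
    by (simp add: r_def power_divide real_sqrt_power)
  finally have vol: "measure lborel (ball z r) = measure lborel (ball (0 :: real^'p) 1) / sqrt (lambda_max A ^ CARD('p))" .
  have "ennreal (c * E * (measure lborel (ball (0 :: real^'p) 1) / sqrt (lambda_max A ^ CARD('p))))
      = ennreal (c * E) * ennreal (measure lborel (ball z r))"
    unfolding vol using c(1) Lam by (intro ennreal_mult) (auto simp: E_def)
  also have "\<dots> = (\<integral>\<^sup>+b. ennreal (c * E) * indicator (ball z r) b \<partial>lborel)"
    using emeasure_lborel_ball_finite[of z r] by (simp add: nn_integral_cmult_indicator emeasure_eq_ennreal_measure)
  also have "\<dots> \<le> (\<integral>\<^sup>+b. ennreal (g b * (lik sig n h b / lik sig n h beta0)) \<partial>lborel)"
    by (rule nn_integral_mono[OF dom])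
  finally show ?thesis by (simp add: E_def)
qed

section \<open>Convergence of the posterior\<close>

lemma outer_prob_nonneg: "outer_prob M S \<ge> 0"
  unfolding outer_prob_def by (rule cINF_greatest) auto

lemma outer_prob_le: "A \<in> sets M \<Longrightarrow> S \<inter> space M \<subseteq> A \<Longrightarrow> outer_prob M S \<le> measure M A"
  unfolding outer_prob_def by (rule cINF_lower) (auto intro!: bdd_belowI[of _ 0])

lemma outer_prob_cover:
  assumes "e > 0"
  obtains A where "A \<in> sets M" "S \<inter> space M \<subseteq> A" "measure M A < outer_prob M S + e"
proof -
  have "(measure M ` {A \<in> sets M. S \<inter> space M \<subseteq> A}) \<noteq> {}" by auto
  from cInf_lessD[OF this, of "outer_prob M S + e"] show thesis
    using assms that by (auto simp: outer_prob_def)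
qed

lemma outer_prob_subadditive:
  assumes "S \<inter> space M \<subseteq> T \<union> U"
  shows "outer_prob M S \<le> outer_prob M T + outer_prob M U"
proof (rule field_le_epsilon)
  fix e :: real assume "e > 0"
  then have e: "e / 2 > 0" by simp
  obtain A where A: "A \<in> sets M" "T \<inter> space M \<subseteq> A" "measure M A < outer_prob M T + e / 2"
    using outer_prob_cover[OF e] .
  obtain B where B: "B \<in> sets M" "U \<inter> space M \<subseteq> B" "measure M B < outer_prob M U + e / 2"
    using outer_prob_cover[OF e] .
  have "outer_prob M S \<le> measure M (A \<union> B)"
    using A B assms by (intro outer_prob_le) auto
  also have "\<dots> \<le> measure M A + measure M B" using A(1) B(1) by (rule measure_Un_le)
  finally show "outer_prob M S \<le> outer_prob M T + outer_prob M U + e" using A(3) B(3) by simp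
qed

text \<open>The deterministic core: randomness enters only through three conditions on the history.
  The thresholds do not depend on \<open>n\<close> or \<open>h\<close>, so what remains is to bound
  the probabilities that the conditions fail.\<close>

lemma tv_dist_posterior_mvn_le:
  fixes prior :: "real^'p \<Rightarrow> real" and beta0 :: "real^'p" and sig e K :: real
  assumes s: "sig > 0"
    and prior: "\<And>b. prior b \<ge> 0" "integrable lborel prior" "(\<integral>b. prior b \<partial>lborel) = 1"
    and cont: "continuous_on UNIV prior" and g0: "prior beta0 > 0"
    and e: "e > 0"
  shows "\<exists>d>0. \<exists>M. \<forall>n h. M < lambda_min (gram n h) \<longrightarrow>
    \<bar>ln (lambda_max (gram n h)) / lambda_min (gram n h)\<bar> \<le> d \<longrightarrow>
    (\<integral>\<^sup>+b. ennreal (prior b * (lik sig n h b / lik sig n h beta0)) \<partial>lborel) \<le> ennreal K \<longrightarrow>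
    tv_dist (posterior prior sig n h) (mvn (beta_hat n h) (sig\<^sup>2 *\<^sub>R matrix_inv (gram n h))) \<le> e"
proof -
  define g where "g = prior beta0"
  \<comment> \<open>The final bound is \<open>2 * r / (1 - r)\<close>, which is at most
    \<open>4 * r\<close> for \<open>r \<le> 1 / 2\<close>.\<close>
  define r where "r = min (1 / 2) (e / 4)"
  have r: "0 < r" "r \<le> 1 / 2" "4 * r \<le> e" using e by (auto simp: r_def)
  have gpos: "g > 0" using g0 by (simp add: g_def)
  have "isCont prior beta0" using cont by (simp add: continuous_on_eq_continuous_at)
  then obtain D where D: "D > 0" "\<And>b. dist b beta0 < D \<Longrightarrow> dist (prior b) g < r / 3 * g"
    using r gpos unfolding continuous_at_eps_delta g_def
    by (metis mult_pos_pos divide_pos_pos zero_less_numeral)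
  \<comment> \<open>Halving leaves room for two steps of length \<open>d\<close>: from
    \<open>beta0\<close> to the estimate, and from the estimate to a point near it.\<close>
  define d where "d = D / 2"
  have d: "d > 0" using D by (simp add: d_def)
  have near: "\<bar>prior b - g\<bar> \<le> r / 3 * g" if "norm (b - beta0) < 2 * d" for b
    using D(2)[of b] that by (simp add: dist_norm d_def)
  have lower: "g / 2 \<le> prior b" if "norm (b - beta0) < 2 * d" for b
  proof -
    have "r / 3 * g \<le> 1 / 2 * g" using r gpos by (intro mult_right_mono) auto
    then show ?thesis using near[OF that] by linarith
  qed
  \<comment> \<open>The unit for all exponents: the density tail decays with \<open>4 * k\<close>,
    while the tail mass and the likelihood ratio carry \<open>2 * k\<close>. The power of the
    largest eigenvalue will cost at most one \<open>k\<close>.\<close>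
  define k where "k = d\<^sup>2 / (8 * sig\<^sup>2)"
  have k: "k > 0" using d s by (simp add: k_def)
  define p where "p = real CARD('p)"
  have p: "p > 0" by (simp add: p_def)
  define N where "N = sqrt ((2 * pi * sig\<^sup>2) ^ CARD('p))"
  have N: "N > 0" using s by (simp add: N_def)
  define V where "V = measure lborel (ball (0 :: real^'p) 1)"
  have V: "V > 0" by (simp add: V_def content_ball_pos)
  have lim0: "((\<lambda>x. exp (- (k * x))) \<longlongrightarrow> 0) at_top"
    using k by (intro filterlim_compose[OF exp_at_bot] filterlim_compose[OF filterlim_uminus_at_bot_at_top]
        filterlim_tendsto_pos_mult_at_top[OF tendsto_const] filterlim_ident)
  have lim1: "filterlim (\<lambda>x. exp (k * x)) at_top at_top"
    using k by (intro filterlim_compose[OF exp_at_top]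
        filterlim_tendsto_pos_mult_at_top[OF tendsto_const] filterlim_ident)
  \<comment> \<open>Four demands on the smallest eigenvalue, in order: small density in the tail,
    small tail mass, a mixture ratio forced above \<open>K\<close>, and the condition for the ball
    argument.\<close>
  have "eventually (\<lambda>x. exp (- (k * x)) < N * (r * g / 3)) at_top"
    using N r gpos by (intro order_tendstoD(2)[OF lim0]) simp
  moreover have "eventually (\<lambda>x. exp (- (k * x)) < r / 3 / sqrt (2 ^ CARD('p))) at_top"
    using r by (intro order_tendstoD(2)[OF lim0]) simp
  moreover have "eventually (\<lambda>x. K / (g / 2 * V) < exp (k * x)) at_top"
    using lim1 by (simp add: filterlim_at_top_dense)
  moreover have "eventually (\<lambda>x. 4 / d\<^sup>2 < x) at_top" by (rule eventually_gt_at_top)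
  ultimately have "eventually (\<lambda>x. exp (- (k * x)) < N * (r * g / 3) \<and> exp (- (k * x)) < r / 3 / sqrt (2 ^ CARD('p))
      \<and> K / (g / 2 * V) < exp (k * x) \<and> 4 / d\<^sup>2 < x) at_top"
    by eventually_elim auto
  then obtain M where M: "\<And>x. x \<ge> M \<Longrightarrow> exp (- (k * x)) < N * (r * g / 3) \<and> exp (- (k * x)) < r / 3 / sqrt (2 ^ CARD('p))
      \<and> K / (g / 2 * V) < exp (k * x) \<and> 4 / d\<^sup>2 < x"
    unfolding eventually_at_top_linorder by blast
  show ?thesis
  \<comment> \<open>The constant \<open>2 * k / p\<close> is chosen so that
    \<open>sqrt (L ^ CARD('p))\<close> is at most \<open>exp (k * l)\<close>.\<close>
  proof (rule exI[of _ "2 * k / p"], intro conjI exI[of _ M] allI impI)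
    show "2 * k / p > 0" using k p by simp
    fix n and h :: "'p hist"
    define A where "A = gram n h"
    define l where "l = lambda_min A"
    define L where "L = lambda_max A"
    define b where "b = beta_hat n h"
    assume "M < lambda_min (gram n h)"
    then have "l \<ge> M" by (simp add: l_def A_def)
    note Ml = M[OF this]
    have l4: "4 / d\<^sup>2 < l" using Ml by simp
    have "0 < 4 / d\<^sup>2" using d by simp
    with l4 have l: "l > 0" by linarith
    have ld: "4 \<le> l * d\<^sup>2" using l4 d by (simp add: field_simps)
    have sym: "transpose A = A" unfolding A_def by (rule transpose_gram)
    have det: "det A > 0" using det_pos_if_lambda_min_pos[OF sym] l by (simp add: l_def)
    have L: "L > 0" using l lambda_min_le_lambda_max[OF sym] by (simp add: l_def L_def)
    assume "\<bar>ln (lambda_max (gram n h)) / lambda_min (gram n h)\<bar> \<le> 2 * k / p"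
    then have "ln L / l \<le> 2 * k / p" unfolding l_def L_def A_def by linarith
    then have lnL: "p / 2 * ln L \<le> k * l" using l p by (simp add: field_simps)
    have "sqrt (L ^ CARD('p)) = exp (p / 2 * ln L)"
      using L by (simp add: powr_half_sqrt[symmetric] powr_realpow[symmetric] powr_powr p_def)
         (simp add: powr_def)
    then have sL: "sqrt (L ^ CARD('p)) \<le> exp (k * l)" using lnL by simp
    have sL0: "sqrt (L ^ CARD('p)) > 0" using L by simp
    have kl: "l * d\<^sup>2 / (2 * sig\<^sup>2) = 4 * (k * l)" "l * d\<^sup>2 / (4 * sig\<^sup>2) = 2 * (k * l)"
      using s by (simp_all add: k_def field_simps)
    assume ZK: "(\<integral>\<^sup>+b. ennreal (prior b * (lik sig n h b / lik sig n h beta0)) \<partial>lborel) \<le> ennreal K"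
    \<comment> \<open>Consistency: otherwise the mixture ratio would be at least
      \<open>g / 2 * V * exp (k * l)\<close>, which \<open>M\<close> makes larger than
      \<open>K\<close>.\<close>
    have bd: "norm (b - beta0) < d"
    proof (rule ccontr)
      assume "\<not> norm (b - beta0) < d"
      then have "ennreal (g / 2 * exp (l * d\<^sup>2 / (4 * sig\<^sup>2)) * (V / sqrt (L ^ CARD('p))))
          \<le> (\<integral>\<^sup>+b. ennreal (prior b * (lik sig n h b / lik sig n h beta0)) \<partial>lborel)"
        unfolding l_def L_def A_def V_def using l ld gpos lower s d
        by (intro mixture_likelihood_ratio_ge) (auto simp: l_def A_def b_def)
      with ZK have "ennreal (g / 2 * exp (l * d\<^sup>2 / (4 * sig\<^sup>2)) * (V / sqrt (L ^ CARD('p)))) \<le> ennreal K"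
        by (rule order_trans[rotated])
      moreover have "K < g / 2 * V * exp (k * l)" using Ml gpos V by (simp add: field_simps)
      moreover have "g / 2 * V * exp (k * l) \<le> g / 2 * exp (l * d\<^sup>2 / (4 * sig\<^sup>2)) * (V / sqrt (L ^ CARD('p)))"
      proof -
        have "exp (k * l) * sqrt (L ^ CARD('p)) \<le> exp (k * l) * exp (k * l)" using sL by simp
        also have "\<dots> = exp (l * d\<^sup>2 / (4 * sig\<^sup>2))" by (simp add: kl exp_add[symmetric])
        finally have "exp (k * l) \<le> exp (l * d\<^sup>2 / (4 * sig\<^sup>2)) / sqrt (L ^ CARD('p))"
          using sL0 by (simp add: pos_le_divide_eq)
        then have "g / 2 * V * exp (k * l) \<le> g / 2 * V * (exp (l * d\<^sup>2 / (4 * sig\<^sup>2)) / sqrt (L ^ CARD('p)))"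
          using gpos V by (intro mult_left_mono) auto
        then show ?thesis by (simp add: mult_ac)
      qed
      \<comment> \<open>As \<open>ennreal\<close> truncates negative reals to 0, positivity is
        needed to carry the comparison with \<open>K\<close> back to the reals.\<close>
      moreover have "0 < g / 2 * V * exp (k * l)" using gpos V by simp
      ultimately show False unfolding ennreal_le_iff2 by linarith
    qed
    let ?phi = "gauss_density A b sig"
    have near': "\<bar>prior c - g\<bar> \<le> r / 3 * g" if "norm (c - b) < d" for c
      using that bd norm_triangle_ineq[of "c - b" "b - beta0"] by (intro near) simp
    have C: "sqrt (L ^ CARD('p)) / N * exp (- l * d\<^sup>2 / (2 * sig\<^sup>2)) \<le> r * g / 3"
    proof -
      have "sqrt (L ^ CARD('p)) * exp (- l * d\<^sup>2 / (2 * sig\<^sup>2)) \<le> exp (k * l) * exp (- (4 * (k * l)))"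
        using sL kl(1) by simp
      also have "\<dots> \<le> exp (- (k * l))" using k l by (simp add: exp_add[symmetric])
      also have "\<dots> \<le> N * (r * g / 3)" using Ml by simp
      finally show ?thesis using N by (simp add: field_simps)
    qed
    have T: "sqrt (2 ^ CARD('p)) * exp (- l * d\<^sup>2 / (4 * sig\<^sup>2)) \<le> r / 3"
    proof -
      have "exp (- l * d\<^sup>2 / (4 * sig\<^sup>2)) \<le> exp (- (k * l))" using kl(2) k l by simp
      also have "\<dots> \<le> r / 3 / sqrt (2 ^ CARD('p))" using Ml by simp
      finally show ?thesis by (simp add: field_simps)
    qed
    have posA: "lambda_min A > 0" using l by (simp add: l_def)
    have r3: "0 \<le> r / 3" using r by simp
    note dev = prior_deviation_le[OF sym posA s less_imp_le[OF d] prior(1,2,3) less_imp_le[OF gpos] r3 near']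
    \<comment> \<open>The three terms stand for prior variation near the estimate, prior mass in the
      tail and Gaussian mass in the tail; each is at most \<open>r * g / 3\<close>.\<close>
    have "(\<integral>c. \<bar>prior c - g\<bar> * ?phi c \<partial>lborel) \<le> r / 3 * g
        + sqrt (L ^ CARD('p)) / N * exp (- l * d\<^sup>2 / (2 * sig\<^sup>2))
        + g * (sqrt (2 ^ CARD('p)) * exp (- l * d\<^sup>2 / (4 * sig\<^sup>2)))"
      using dev(2) by (simp add: l_def L_def N_def)
    also have "\<dots> \<le> r / 3 * g + r * g / 3 + g * (r / 3)"
      using C T gpos r by (intro add_mono mult_left_mono) auto
    finally have dev2: "(\<integral>c. \<bar>prior c - g\<bar> * ?phi c \<partial>lborel) \<le> r * g" by (simp add: field_simps)
    have rg: "r * g < g" using r gpos by simp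
    have iphi: "integrable lborel ?phi" "(\<integral>b. ?phi b \<partial>lborel) = 1"
      using has_bochner_integral_gauss_density[OF sym posA s, of b]
      by (auto simp: has_bochner_integral_iff)
    have "tv_dist (posterior prior sig n h) (mvn (beta_hat n h) (sig\<^sup>2 *\<^sub>R matrix_inv (gram n h)))
        \<le> 2 * (r * g) / (g - r * g)"
      unfolding mvn_eq_gauss_density[OF det[unfolded A_def] s]
        posterior_eq_reweighted_gauss_density[OF det[unfolded A_def] s]
      using dev(1) dev2 rg iphi prior(1) borel_measurable_integrable[OF prior(2)] gauss_density_nonneg[OF det]
      unfolding A_def b_def by (intro tv_dist_reweighted_le) auto
    also have "\<dots> = 2 * r / (1 - r)" using gpos r by (simp add: divide_simps) (simp add: algebra_simps)
    also have "\<dots> \<le> 2 * r / (1 / 2)" using r by (intro divide_left_mono) auto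
    also have "\<dots> \<le> e" using r by simp
    finally show "tv_dist (posterior prior sig n h) (mvn (beta_hat n h) (sig\<^sup>2 *\<^sub>R matrix_inv (gram n h))) \<le> e" .
  qed
qed

theorem theorem1:
  fixes Lam :: "nat \<Rightarrow> ('p::finite) hist \<Rightarrow> (real^'p) measure"
    and beta0 :: "real^'p" and sig :: real and prior :: "real^'p \<Rightarrow> real"
  assumes sigma_pos: "sig > 0"
    and Lam_kernel: "\<And>j. Lam j \<in> hist_space j \<rightarrow>\<^sub>M prob_algebra borel"
    and prior_nonneg: "\<And>b. prior b \<ge> 0"
    and prior_integrable: "integrable lborel prior"
    and prior_density: "(\<integral>b. prior b \<partial>lborel) = 1"
    and prior_cont: "continuous_on UNIV prior"
    and prior_pos: "prior beta0 > 0"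
    and lmin_infty: "\<And>M. (\<lambda>n. outer_prob (data_law Lam beta0 sig n)
                         {h. lambda_min (gram n h) \<le> M}) \<longlonglongrightarrow> 0"
    and log_lmax: "\<And>e. e > 0 \<Longrightarrow> (\<lambda>n. outer_prob (data_law Lam beta0 sig n)
                         {h. \<bar>ln (lambda_max (gram n h)) / lambda_min (gram n h)\<bar> > e}) \<longlonglongrightarrow> 0"
  shows "\<And>e. e > 0 \<Longrightarrow> (\<lambda>n. outer_prob (data_law Lam beta0 sig n)
           {h. tv_dist (posterior prior sig n h)
                 (mvn (beta_hat n h) (sig\<^sup>2 *\<^sub>R matrix_inv (gram n h))) > e}) \<longlonglongrightarrow> 0"
proof -
  fix e :: real assume e: "e > 0"
  interpret adaptive_gaussian_sampling Lam beta0 sig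
    using sigma_pos Lam_kernel by unfold_locales
  let ?bad = "\<lambda>n. {h. tv_dist (posterior prior sig n h)
                 (mvn (beta_hat n h) (sig\<^sup>2 *\<^sub>R matrix_inv (gram n h))) > e}"
  let ?Z = "\<lambda>n h. \<integral>\<^sup>+b. ennreal (prior b * (lik sig n h b / lik sig n h beta0)) \<partial>lborel"
  have [measurable]: "prior \<in> borel_measurable borel"
    using borel_measurable_integrable[OF prior_integrable] by simp
  have Zm: "?Z n \<in> borel_measurable (law n)" for n
    by measurable
  have Z1: "(\<integral>\<^sup>+h. ?Z n h \<partial>law n) = 1" for n
    using nn_integral_mixture_likelihood_ratio[of prior n] prior_nonneg prior_integrable prior_density
    by (simp add: nn_integral_eq_integral)
  show "(\<lambda>n. outer_prob (law n) (?bad n)) \<longlonglongrightarrow> 0"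
  proof (rule tendstoI)
    fix eta :: real assume eta: "eta > 0"
    \<comment> \<open>Markov's inequality with mean 1 gives exceedance probability at most
      \<open>1 / K = eta / 2\<close>. \<open>K\<close> is fixed before \<open>d\<close> and
      \<open>M\<close>, which depend on it; only then does \<open>n\<close> grow.\<close>
    define K where "K = 2 / eta"
    have K: "K > 0" using eta by (simp add: K_def)
    obtain d M where d: "d > 0" and good:
      "\<forall>n h. M < lambda_min (gram n h) \<longrightarrow>
        \<bar>ln (lambda_max (gram n h)) / lambda_min (gram n h)\<bar> \<le> d \<longrightarrow> ?Z n h \<le> ennreal K \<longrightarrow>
        tv_dist (posterior prior sig n h) (mvn (beta_hat n h) (sig\<^sup>2 *\<^sub>R matrix_inv (gram n h))) \<le> e"
      using tv_dist_posterior_mvn_le[OF sigma_pos prior_nonneg prior_integrable prior_density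
          prior_cont prior_pos e, where K = K] by (elim exE conjE)
    let ?S = "\<lambda>n. {h. lambda_min (gram n h) \<le> M}"
    let ?T = "\<lambda>n. {h. \<bar>ln (lambda_max (gram n h)) / lambda_min (gram n h)\<bar> > d}"
    have bound: "outer_prob (law n) (?bad n) \<le> outer_prob (law n) (?S n) + outer_prob (law n) (?T n) + eta / 2" for n
    proof -
      interpret L: prob_space "law n" by (rule prob_space_law)
      \<comment> \<open>The event that the mixture ratio reaches \<open>K\<close>, in the form of
        Markov's inequality. It is measurable, whereas the two eigenvalue events are handled by
        outer probability.\<close>
      define B where "B = {h \<in> space (law n). 1 \<le> ennreal (1 / K) * ?Z n h}"
      have B: "B \<in> sets (law n)" unfolding B_def using Zm[of n] by measurable
      have ZB: "?Z n h \<le> ennreal K" if "h \<in> space (law n)" "h \<notin> B" for h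
      proof (rule ccontr)
        assume "\<not> ?Z n h \<le> ennreal K"
        then have "ennreal (1 / K) * ennreal K \<le> ennreal (1 / K) * ?Z n h"
          by (intro mult_left_mono) auto
        moreover have "ennreal (1 / K) * ennreal K = 1" using K by (simp add: ennreal_mult[symmetric])
        ultimately show False using that by (simp add: B_def)
      qed
      have "emeasure (law n) B \<le> ennreal (1 / K) * (\<integral>\<^sup>+h. ?Z n h * indicator (space (law n)) h \<partial>law n)"
        unfolding B_def using Zm[of n] by (intro nn_integral_Markov_inequality) auto
      also have "(\<integral>\<^sup>+h. ?Z n h * indicator (space (law n)) h \<partial>law n) = (\<integral>\<^sup>+h. ?Z n h \<partial>law n)"
        by (intro nn_integral_cong) simp
      finally have "emeasure (law n) B \<le> ennreal (1 / K)"
        using Z1[of n] by simp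
      then have mB: "measure (law n) B \<le> eta / 2"
        using K by (simp add: L.emeasure_eq_measure K_def)
      have "outer_prob (law n) (?bad n) \<le> outer_prob (law n) (?S n \<union> ?T n) + outer_prob (law n) B"
      proof (rule outer_prob_subadditive, rule subsetI)
        fix h assume h: "h \<in> ?bad n \<inter> space (law n)"
        show "h \<in> ?S n \<union> ?T n \<union> B"
        proof (rule ccontr)
          assume "h \<notin> ?S n \<union> ?T n \<union> B"
          then have "M < lambda_min (gram n h)" "\<bar>ln (lambda_max (gram n h)) / lambda_min (gram n h)\<bar> \<le> d" "h \<notin> B"
            by (simp_all only: Un_iff mem_Collect_eq de_Morgan_disj not_le not_less simp_thms)
          with good[rule_format, of n h] ZB[of h] h show False by force
        qed
      qed
      also have "outer_prob (law n) (?S n \<union> ?T n) \<le> outer_prob (law n) (?S n) + outer_prob (law n) (?T n)"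
        by (rule outer_prob_subadditive) auto
      also have "outer_prob (law n) B \<le> eta / 2"
        using outer_prob_le[OF B, of B] mB by simp
      finally show ?thesis by simp
    qed
    have "(\<lambda>n. outer_prob (law n) (?S n) + outer_prob (law n) (?T n)) \<longlonglongrightarrow> 0 + 0"
      by (intro tendsto_add lmin_infty log_lmax d)
    then have "eventually (\<lambda>n. outer_prob (law n) (?S n) + outer_prob (law n) (?T n) < eta / 2) sequentially"
      using eta by (intro order_tendstoD(2)) auto
    then show "eventually (\<lambda>n. dist (outer_prob (law n) (?bad n)) 0 < eta) sequentially"
    proof eventually_elim
      case (elim n)
      then show ?case using bound[of n] outer_prob_nonneg[of "law n" "?bad n"] by simp
    qed
  qed
qed

end
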